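(* Consider the Poisson small-world random graph on $n$ with parameters $0 < \alpha < 2$, and arbitrarily large constants $c > 0$ and $\overline{d} > 0$. Suppose the source $s$ and destination $t$ are chosen uniformly at random from the node set. Then, for any $\gamma < (2-\alpha)/6$, the number of hops for message delivery from $s$ to $t$ in any decentralised routing algorithm exceeds $n^{\gamma}$ with high probability, i.e. with probability tending to $1$ as $n \to \infty$.
   Context: **Model.** For each $n \in \mathbb{N}$ a random graph is defined as follows. Nodes are the points of a Poisson process of rate $1$ on the square $[0,\sqrt{n}]^2$. The distance $r(u,v)$ is the Euclidean distance, with edge effects ignored, i.e. distances are those on the torus obtained by identifying opposite edges of the square. Each node $x$ is linked to all nodes at distance less than $\sqrt{c \log n}$ from it; these links are called local edges and the corresponding nodes the local contacts of $x$. For two nodes $u,v$ with $r(u,v) > \sqrt{c\log n}$, the edge $(u,v)$ is present with probability $\min(a_n r(u,v)^{-\alpha}, 1)$, independently for different node pairs (given the node positions); such edges are called shortcuts, and their endpoints are shortcut contacts of each other. The parameter $a_n$ is chosen so that the expected number of shortcuts per node equals the specified constant $\overline{d}$. **Decentralised routing algorithm.** Each node knows its own location, the locations of all its local contacts (those within distance $\sqrt{c\log n}$) and of all its shortcut neighbours (including nodes from which shortcuts are incident to it), and the location of the destination $t$. There is no global knowledge of the graph topology. A decentralised routing algorithm specifies a (possibly random) sequence of nodes $s = x_0, x_1, \ldots, x_k = t, x_{k+1} = t, \ldots$ where each node $x_i$ is chosen from among the local or shortcut contacts of the nodes $\{x_0,\ldots,x_{i-1}\}$, the choice being based only on the information known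 to the nodes $x_0,\ldots,x_{i-1}$ (and possibly independent randomisation). The number of hops is the first index $k$ with $x_k = t$ (infinite if there is none). *)

theory Defs
  imports "HOL-Probability.Probability"
begin

section \<open>Nodes on the torus\<close>

type_synonym point = "real \<times> real"

definition square :: "nat \<Rightarrow> point set" where
  "square n = {0..sqrt n} \<times> {0..sqrt n}"

text \<open>Distance on the torus obtained from \<^term>\<open>square n\<close> by identifying opposite edges: in each
  coordinate, the shorter of the two arcs of a circle of length \<^term>\<open>sqrt n\<close>.\<close>

definition circle_dist :: "real \<Rightarrow> real \<Rightarrow> real \<Rightarrow> real" where
  "circle_dist L x y = min \<bar>x - y\<bar> (L - \<bar>x - y\<bar>)"

definition torus_dist :: "nat \<Rightarrow> point \<Rightarrow> point \<Rightarrow> real" where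
  "torus_dist n u v =
     sqrt ((circle_dist (sqrt n) (fst u) (fst v))\<^sup>2 + (circle_dist (sqrt n) (snd u) (snd v))\<^sup>2)"

definition local_radius :: "real \<Rightarrow> nat \<Rightarrow> real" where
  "local_radius c n = sqrt (c * ln n)"

text \<open>A Poisson process of rate 1 on a bounded region \<^term>\<open>S\<close>. Its points are almost surely distinct,
  so it is represented by the random set of its points.\<close>

definition poisson_process :: "point set \<Rightarrow> 'w measure \<Rightarrow> ('w \<Rightarrow> point set) \<Rightarrow> bool" where
  "poisson_process S M V \<longleftrightarrow>
     (AE w in M. finite (V w) \<and> V w \<subseteq> S) \<and>
     (\<forall>B \<in> sets borel. B \<subseteq> S \<longrightarrow>
        (\<lambda>w. card (V w \<inter> B)) \<in> M \<rightarrow>\<^sub>M count_space UNIV \<and>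
        (\<forall>k. measure M {w \<in> space M. card (V w \<inter> B) = k}
             = exp (- measure lborel B) * measure lborel B ^ k / fact k)) \<and>
     (\<forall>(I :: nat set) B. finite I \<longrightarrow> (\<forall>i \<in> I. B i \<in> sets borel \<and> B i \<subseteq> S) \<longrightarrow>
        disjoint_family_on B I \<longrightarrow>
        prob_space.indep_vars M (\<lambda>_. count_space UNIV) (\<lambda>i w. card (V w \<inter> B i)) I)"

section \<open>The random graph\<close>

text \<open>A graph is a triple \<open>(m, x, e)\<close>: its nodes are the points \<open>x 0, \<dots>, x (m - 1)\<close>, and for
  \<open>i < j < m\<close> the value \<open>e (i, j)\<close> tells whether \<open>x i\<close> and \<open>x j\<close> are joined by a shortcut. Local
  edges are determined by the positions. The numbering of the nodes only serves to write down laws: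
  routing algorithms see points, never indices. A network is a graph with the indices of a source
  and a destination.\<close>

type_synonym graph = "nat \<times> (nat \<Rightarrow> point) \<times> (nat \<times> nat \<Rightarrow> bool)"
type_synonym network = "graph \<times> nat \<times> nat"

definition graph_space :: "graph measure" where
  "graph_space = count_space UNIV \<Otimes>\<^sub>M (Pi\<^sub>M UNIV (\<lambda>_. borel) \<Otimes>\<^sub>M Pi\<^sub>M UNIV (\<lambda>_. count_space UNIV))"

definition network_space :: "network measure" where
  "network_space = graph_space \<Otimes>\<^sub>M (count_space UNIV \<Otimes>\<^sub>M count_space UNIV)"

definition num_nodes :: "network \<Rightarrow> nat" where
  "num_nodes w = fst (fst w)"

definition position :: "network \<Rightarrow> nat \<Rightarrow> point" where
  "position w = fst (snd (fst w))"

definition shortcut :: "network \<Rightarrow> nat \<times> nat \<Rightarrow> bool" where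
  "shortcut w = snd (snd (fst w))"

definition nodes :: "network \<Rightarrow> point set" where
  "nodes w = position w ` {..<num_nodes w}"

definition source :: "network \<Rightarrow> point" where
  "source w = position w (fst (snd w))"

definition destination :: "network \<Rightarrow> point" where
  "destination w = position w (snd (snd w))"

definition local_contacts :: "real \<Rightarrow> nat \<Rightarrow> network \<Rightarrow> point \<Rightarrow> point set" where
  "local_contacts c n w u = {v \<in> nodes w. v \<noteq> u \<and> torus_dist n u v < local_radius c n}"

definition shortcut_contacts :: "network \<Rightarrow> point \<Rightarrow> point set" where
  "shortcut_contacts w u =
     {v. \<exists>i < num_nodes w. \<exists>j < num_nodes w. position w i = u \<and> position w j = v \<and>
           (shortcut w (i, j) \<or> shortcut w (j, i))}"

text \<open>The law of the shortcuts given \<open>m\<close> nodes at positions \<open>x\<close>: independent for distinct pairs of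
  nodes, and \<^term>\<open>False\<close> at all arguments that are not pairs \<open>i < j < m\<close> at distance more than
  the local radius.\<close>

definition shortcut_pmf ::
    "real \<Rightarrow> real \<Rightarrow> real \<Rightarrow> nat \<Rightarrow> nat \<Rightarrow> (nat \<Rightarrow> point) \<Rightarrow> (nat \<times> nat \<Rightarrow> bool) pmf" where
  "shortcut_pmf c \<alpha> a n m x =
     Pi_pmf {(i, j). i < j \<and> j < m \<and> local_radius c n < torus_dist n (x i) (x j)} False
       (\<lambda>(i, j). bernoulli_pmf (min (a * torus_dist n (x i) (x j) powr - \<alpha>) 1))"

text \<open>\<^term>\<open>W\<close> is the joint law of the Poisson small-world graph with parameters \<open>c\<close>, \<open>\<alpha>\<close>,
  \<open>a = a\<^sub>n\<close>, and of a source and a destination. The last two conjuncts are the conditional law of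
  the shortcuts given the nodes, and of the endpoints (independent and uniform on the nodes) given
  the graph, in integrated form.\<close>

definition poisson_small_world ::
    "real \<Rightarrow> real \<Rightarrow> real \<Rightarrow> nat \<Rightarrow> network measure \<Rightarrow> bool" where
  "poisson_small_world c \<alpha> a n W \<longleftrightarrow>
     prob_space W \<and> sets W = sets network_space \<and>
     poisson_process (square n) W nodes \<and>
     (AE w in W. inj_on (position w) {..<num_nodes w}) \<and>
     (\<forall>m. \<forall>A \<in> sets (Pi\<^sub>M UNIV (\<lambda>_. borel)). \<forall>f.
        measure W {w \<in> space W. num_nodes w = m \<and> position w \<in> A \<and> shortcut w = f} =
        (LINT w : {w \<in> space W. num_nodes w = m \<and> position w \<in> A} | W.
           pmf (shortcut_pmf c \<alpha> a n m (position w)) f)) \<and>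
     (\<forall>C \<in> sets graph_space. \<forall>i j.
        measure W {w \<in> space W. fst w \<in> C \<and> i < num_nodes w \<and> j < num_nodes w \<and> snd w = (i, j)} =
        (LINT w : {w \<in> space W. fst w \<in> C \<and> i < num_nodes w \<and> j < num_nodes w} | W.
           1 / (real (num_nodes w))\<^sup>2))"

text \<open>The expected number of shortcuts per node, i.e. of a typical node of the process: the expected
  total number of shortcut contacts of all nodes, divided by the expected number of nodes.\<close>

definition mean_shortcuts :: "network measure \<Rightarrow> real" where
  "mean_shortcuts W =
     (\<integral>w. (\<Sum>u \<in> nodes w. real (card (shortcut_contacts w u))) \<partial>W) / (\<integral>w. real (card (nodes w)) \<partial>W)"

section \<open>Decentralised routing\<close>

text \<open>What a node knows, apart from the destination: its location, and the locations of its local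
  and of its shortcut contacts.\<close>

type_synonym view = "point \<times> point set \<times> point set"

definition view :: "real \<Rightarrow> nat \<Rightarrow> network \<Rightarrow> point \<Rightarrow> view" where
  "view c n w u = (u, local_contacts c n w u, shortcut_contacts w u)"

definition known_contacts :: "view list \<Rightarrow> point set" where
  "known_contacts vs = (\<Union>(u, L, S) \<in> set vs. L \<union> S)"

text \<open>An algorithm selects the next node from a random seed, the location of the destination and
  the views of the nodes visited so far, in order of visit. The only constraint is that it selects
  a contact of one of these nodes.\<close>

type_synonym 'r algorithm = "'r \<Rightarrow> point \<Rightarrow> view list \<Rightarrow> point"

definition decentralised :: "'r algorithm \<Rightarrow> bool" where
  "decentralised \<A> \<longleftrightarrow>
     (\<forall>\<rho> t vs. known_contacts vs \<noteq> {} \<longrightarrow> \<A> \<rho> t vs \<in> known_contacts vs)"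

text \<open>The list of the nodes \<open>x\<^sub>0, \<dots>, x\<^sub>k\<close>. If \<open>x\<^sub>0\<close> is isolated then there is no admissible \<open>x\<^sub>1\<close>,
  and the message remains at \<open>x\<^sub>0\<close> forever.\<close>

primrec route :: "'r algorithm \<Rightarrow> real \<Rightarrow> nat \<Rightarrow> network \<Rightarrow> 'r \<Rightarrow> nat \<Rightarrow> point list" where
  "route \<A> c n w \<rho> 0 = [source w]"
| "route \<A> c n w \<rho> (Suc k) =
     (let xs = route \<A> c n w \<rho> k; vs = map (view c n w) xs in
      xs @ [if last xs = destination w \<or> known_contacts vs = {} then last xs
            else \<A> \<rho> (destination w) vs])"

definition visited :: "'r algorithm \<Rightarrow> real \<Rightarrow> nat \<Rightarrow> network \<Rightarrow> 'r \<Rightarrow> nat \<Rightarrow> point" where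
  "visited \<A> c n w \<rho> k = last (route \<A> c n w \<rho> k)"

definition hops :: "'r algorithm \<Rightarrow> real \<Rightarrow> nat \<Rightarrow> network \<Rightarrow> 'r \<Rightarrow> enat" where
  "hops \<A> c n w \<rho> =
     (if \<exists>k. visited \<A> c n w \<rho> k = destination w
      then enat (LEAST k. visited \<A> c n w \<rho> k = destination w) else \<infinity>)"

text \<open>The seed is drawn from \<^term>\<open>R\<close> independently of the network; the visited nodes are required
  to be random variables.\<close>

definition routing_algorithm ::
    "real \<Rightarrow> nat \<Rightarrow> network measure \<Rightarrow> 'r measure \<Rightarrow> 'r algorithm \<Rightarrow> bool" where
  "routing_algorithm c n W R \<A> \<longleftrightarrow>
     prob_space R \<and> decentralised \<A> \<and>
     (\<forall>k. (\<lambda>(w, \<rho>). visited \<A> c n w \<rho> k) \<in> W \<Otimes>\<^sub>M R \<rightarrow>\<^sub>M borel)"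

end

theory Submission
  imports Defs "HOL-Real_Asymp.Real_Asymp"
begin

text \<open>
  Fix \<open>max \<gamma> 0 < \<delta> < (2 - \<alpha>) / 6\<close>, let \<open>K\<close> be about \<open>n powr max \<gamma> 0\<close>, and let \<open>D\<close> be the disc of
  radius \<open>r = n powr \<delta>\<close> about the destination. Local edges advance the message by less than
  \<open>sqrt (c ln n)\<close> each, and \<open>K sqrt (c ln n) < r\<close> for large \<open>n\<close>. So a route that starts outside \<open>D\<close>
  and arrives within \<open>K\<close> hops must at some time follow a shortcut into \<open>D\<close>, and the first visit to
  the outer end of this shortcut happens while its inner end is still unvisited
  (\<open>visited_far_from_destination\<close>). Such a shortcut is improbable, for three reasons.

  A shortcut is a fresh coin toss until one of its ends is visited. The event that node \<open>u\<close> is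
  visited at time \<open>k\<close>, that neither \<open>u\<close> nor \<open>v\<close> was visited before, and that \<open>v\<close> lies in \<open>D\<close>, does
  not change when the link between \<open>u\<close> and \<open>v\<close> is inserted or deleted (\<open>exposes_set_link\<close>). Hence
  the conditional probability of this link, given that event, is just its connection probability
  given the positions (\<open>nn_integral_link\<close>).

  Long links are spread over the whole square. Since \<open>\<alpha> < 2\<close>, a positive fraction of all pairs of
  nodes have distance of order \<open>sqrt n\<close>, and each of them is linked with probability at least of
  order \<open>a\<^sub>n n powr (- \<alpha> / 2)\<close>. A bounded mean degree therefore forces \<open>a\<^sub>n\<close> to be at most of order
  \<open>n powr (\<alpha> / 2 - 1)\<close> (\<open>normalisation_bound\<close>), and no shortcut has a probability above \<open>a\<^sub>n\<close> once
  the local radius exceeds 1.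

  The disc \<open>D\<close> contains \<open>O(r\<^sup>2)\<close> nodes on average, although it is centred at a node of the process.
  Averaging over a uniformly chosen destination turns the mean number of nodes in \<open>D\<close> into the mean
  number of pairs of nodes closer than \<open>r\<close>, divided by the number of nodes. The pairs are counted by
  covering the torus with cells and using only second moments of Poisson variables
  (\<open>expected_close_pairs\<close>). The same count shows that the source is unlikely to lie in \<open>D\<close>.

  Altogether, the probability of arriving within \<open>K\<close> hops is at most of order
  \<open>1 / n + r\<^sup>2 / n + K a\<^sub>n r\<^sup>2\<close> (\<open>early_arrival_bound\<close>), and the exponent \<open>max \<gamma> 0 + (\<alpha> / 2 - 1) + 2 \<delta>\<close>
  of the last term is negative by the choice of \<open>\<delta>\<close>.
\<close>

section \<open>The torus and its cells\<close>

lemma circle_dist_commute: "circle_dist L x y = circle_dist L y x"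
  by (simp add: circle_dist_def abs_minus_commute)

lemma circle_dist_nonneg:
  "x \<in> {0..L} \<Longrightarrow> y \<in> {0..L} \<Longrightarrow> 0 \<le> circle_dist L x y"
  by (auto simp: circle_dist_def)

lemma circle_dist_le_half: "circle_dist L x y \<le> L / 2"
  by (auto simp: circle_dist_def min_def)

lemma circle_dist_triangle:
  assumes "x \<in> {0..L}" "y \<in> {0..L}" "z \<in> {0..L}"
  shows "circle_dist L x z \<le> circle_dist L x y + circle_dist L y z"
  using assms unfolding circle_dist_def min_def abs_if by auto

lemma torus_dist_commute: "torus_dist n u v = torus_dist n v u"
  by (simp add: torus_dist_def circle_dist_commute)

lemma torus_dist_self [simp]: "torus_dist n u u = 0"
  by (simp add: torus_dist_def circle_dist_def)

lemma torus_dist_triangle: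
  assumes "u \<in> square n" "v \<in> square n" "w \<in> square n"
  shows "torus_dist n u w \<le> torus_dist n u v + torus_dist n v w"
proof -
  let ?d = "circle_dist (sqrt n)"
  note D = assms[unfolded square_def mem_Times_iff]
  have "torus_dist n u w \<le>
      sqrt ((?d (fst u) (fst v) + ?d (fst v) (fst w))\<^sup>2 + (?d (snd u) (snd v) + ?d (snd v) (snd w))\<^sup>2)"
    unfolding torus_dist_def using D
    by (intro real_sqrt_le_mono add_mono power_mono circle_dist_triangle circle_dist_nonneg) auto
  also have "\<dots> \<le> torus_dist n u v + torus_dist n v w"
    unfolding torus_dist_def by (rule real_sqrt_sum_squares_triangle_ineq)
  finally show ?thesis .
qed

lemma torus_dist_le:
  assumes "u \<in> square n" "v \<in> square n"
  shows "torus_dist n u v \<le> sqrt n"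
proof -
  let ?d = "circle_dist (sqrt n)"
  note D = assms[unfolded square_def mem_Times_iff]
  have "torus_dist n u v \<le> sqrt ((sqrt n / 2)\<^sup>2 + (sqrt n / 2)\<^sup>2)"
    unfolding torus_dist_def using D
    by (intro real_sqrt_le_mono add_mono power_mono circle_dist_le_half circle_dist_nonneg) auto
  also have "\<dots> \<le> sqrt n"
    by (intro real_sqrt_le_mono) (simp add: power_divide)
  finally show ?thesis .
qed

lemma circle_dist_le_torus_dist:
  assumes "u \<in> square n" "v \<in> square n"
  shows "circle_dist (sqrt n) (fst u) (fst v) \<le> torus_dist n u v"
    and "circle_dist (sqrt n) (snd u) (snd v) \<le> torus_dist n u v"
  using assms by (auto simp: torus_dist_def square_def intro!: real_le_rsqrt)

text \<open>Counting the arcs modulo \<open>M\<close> joins the two pieces of an arc that the shift \<open>\<theta>\<close> moves across the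
  origin.\<close>

definition strip :: "real \<Rightarrow> nat \<Rightarrow> real \<Rightarrow> nat \<Rightarrow> real set" where
  "strip L M \<theta> i = {x \<in> {0..L}. \<lfloor>x * M / L + \<theta>\<rfloor> mod int M = int i}"

definition cell :: "nat \<Rightarrow> nat \<Rightarrow> real \<times> real \<Rightarrow> nat \<times> nat \<Rightarrow> point set" where
  "cell n M \<theta> i = strip (sqrt n) M (fst \<theta>) (fst i) \<times> strip (sqrt n) M (snd \<theta>) (snd i)"

text \<open>Two points less than half a cell apart may be separated by a cell boundary, but the subdivision
  shifted by half a cell then has no boundary between them. Using each coordinate both unshifted and
  shifted gives four families of cells, such that close points always share a cell of some family.\<close>

definition shifts :: "(real \<times> real) set" where
  "shifts = {0, 1 / 2} \<times> {0, 1 / 2}"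

lemma finite_shifts [simp]: "finite shifts" and card_shifts: "card shifts = 4"
  by (auto simp: shifts_def card_cartesian_product)

lemma floor_or_shifted_floor_eq:
  fixes X Y :: real
  assumes "X \<le> Y" "Y < X + 1 / 2"
  shows "\<lfloor>X\<rfloor> = \<lfloor>Y\<rfloor> \<or> \<lfloor>X + 1 / 2\<rfloor> = \<lfloor>Y + 1 / 2\<rfloor>"
proof (cases "Y < of_int \<lfloor>X\<rfloor> + 1")
  case True
  then have "\<lfloor>Y\<rfloor> = \<lfloor>X\<rfloor>" using assms by (intro floor_unique) linarith+
  then show ?thesis by simp
next
  case False
  then have "\<lfloor>X + 1 / 2\<rfloor> = \<lfloor>X\<rfloor> + 1" "\<lfloor>Y + 1 / 2\<rfloor> = \<lfloor>X\<rfloor> + 1"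
    using assms by (intro floor_unique; simp; linarith)+
  then show ?thesis by simp
qed

text \<open>The points are compared on the line after scaling the arcs to length 1. If their shorter arc passes
  through the origin, one of them is first moved by a full turn, which changes the number of its arc
  by \<open>M\<close>.\<close>

lemma common_strip:
  assumes "0 < L" "0 < M" and xy: "x \<in> {0..L}" "y \<in> {0..L}"
    and d: "circle_dist L x y < L / (2 * real M)"
  shows "\<exists>\<theta> \<in> {0, 1 / 2}. \<exists>i < M. x \<in> strip L M \<theta> i \<and> y \<in> strip L M \<theta> i"
proof -
  have *: "\<exists>\<theta> \<in> {0, 1 / 2}. \<exists>i < M. x \<in> strip L M \<theta> i \<and> y \<in> strip L M \<theta> i"
    if xy: "x \<in> {0..L}" "y \<in> {0..L}" and le: "x \<le> y" and d: "circle_dist L x y < L / (2 * real M)"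
    for x y
  proof -
    define X Y where "X = x * M / L" and "Y = y * M / L"
    have "X \<le> Y" using le assms by (simp add: X_def Y_def divide_right_mono)
    from d le have "y - x < L / (2 * real M) \<or> x + L - y < L / (2 * real M)"
      by (auto simp: circle_dist_def min_def split: if_splits)
    then have "\<exists>\<theta> \<in> {0, 1 / 2}. \<lfloor>X + \<theta>\<rfloor> mod int M = \<lfloor>Y + \<theta>\<rfloor> mod int M"
    proof
      assume "y - x < L / (2 * real M)"
      then have "Y < X + 1 / 2" using assms by (simp add: X_def Y_def field_simps)
      with \<open>X \<le> Y\<close> floor_or_shifted_floor_eq[of X Y] show ?thesis by force
    next
      assume "x + L - y < L / (2 * real M)"
      then have "(M / L) * (x + L - y) < (M / L) * (L / (2 * real M))"
        using assms by (intro mult_strict_left_mono) auto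
      moreover have "(M / L) * (x + L - y) = X + M - Y" "(M / L) * (L / (2 * real M)) = 1 / 2"
        using assms by (auto simp: X_def Y_def field_simps)
      ultimately have "X + M < Y + 1 / 2" by linarith
      moreover have "0 \<le> X" "Y \<le> M" using assms xy by (auto simp: X_def Y_def field_simps)
      then have "Y \<le> X + M" by linarith
      ultimately have "\<lfloor>Y\<rfloor> = \<lfloor>X + of_int (int M)\<rfloor> \<or> \<lfloor>Y + 1 / 2\<rfloor> = \<lfloor>X + 1 / 2 + of_int (int M)\<rfloor>"
        using floor_or_shifted_floor_eq[of Y "X + M"] by (auto simp: algebra_simps)
      then show ?thesis by (simp only: floor_add_int[symmetric]) auto
    qed
    then obtain \<theta> where \<theta>: "\<theta> \<in> {0, 1 / 2}" "\<lfloor>X + \<theta>\<rfloor> mod int M = \<lfloor>Y + \<theta>\<rfloor> mod int M" by blast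
    have "nat (\<lfloor>X + \<theta>\<rfloor> mod int M) < M" "int (nat (\<lfloor>X + \<theta>\<rfloor> mod int M)) = \<lfloor>X + \<theta>\<rfloor> mod int M"
      using assms by (auto simp: nat_less_iff)
    then show ?thesis using \<theta> xy unfolding strip_def X_def Y_def
      by (intro bexI[of _ \<theta>] exI[of _ "nat (\<lfloor>X + \<theta>\<rfloor> mod int M)"]) (auto simp: X_def Y_def)
  qed
  show ?thesis
  proof (cases "x \<le> y")
    case True
    then show ?thesis using *[OF xy True d] by blast
  next
    case False
    then show ?thesis using *[of y x] xy d by (auto simp: circle_dist_commute)
  qed
qed

lemma common_cell:
  assumes "0 < n" "0 < M" "u \<in> square n" "v \<in> square n" "torus_dist n u v < sqrt n / (2 * real M)"
  shows "\<exists>\<theta> \<in> shifts. \<exists>i \<in> {..<M} \<times> {..<M}. u \<in> cell n M \<theta> i \<and> v \<in> cell n M \<theta> i"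
proof -
  have sq: "fst u \<in> {0..sqrt n}" "snd u \<in> {0..sqrt n}" "fst v \<in> {0..sqrt n}" "snd v \<in> {0..sqrt n}"
    using assms by (auto simp: square_def)
  obtain \<theta>1 i1 where 1: "\<theta>1 \<in> {0, 1 / 2}" "i1 < M" "fst u \<in> strip (sqrt n) M \<theta>1 i1"
      "fst v \<in> strip (sqrt n) M \<theta>1 i1"
    using common_strip[of "sqrt n" M "fst u" "fst v"] sq \<open>0 < n\<close> \<open>0 < M\<close>
      le_less_trans[OF circle_dist_le_torus_dist(1)[OF assms(3,4)] assms(5)]
    by (metis of_nat_0_less_iff real_sqrt_gt_zero)
  obtain \<theta>2 i2 where 2: "\<theta>2 \<in> {0, 1 / 2}" "i2 < M" "snd u \<in> strip (sqrt n) M \<theta>2 i2"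
      "snd v \<in> strip (sqrt n) M \<theta>2 i2"
    using common_strip[of "sqrt n" M "snd u" "snd v"] sq \<open>0 < n\<close> \<open>0 < M\<close>
      le_less_trans[OF circle_dist_le_torus_dist(2)[OF assms(3,4)] assms(5)]
    by (metis of_nat_0_less_iff real_sqrt_gt_zero)
  show ?thesis using 1 2
    by (intro bexI[of _ "(\<theta>1, \<theta>2)"] bexI[of _ "(i1, i2)"]) (auto simp: cell_def shifts_def mem_Times_iff)
qed

lemma strip_borel [measurable]: "strip L M \<theta> i \<in> sets borel"
  unfolding strip_def by measurable

lemma cell_borel [measurable]: "cell n M \<theta> i \<in> sets borel"
  unfolding cell_def borel_prod[symmetric] by (intro pair_measureI) auto

lemma cell_subset: "cell n M \<theta> i \<subseteq> square n"
  by (auto simp: cell_def strip_def square_def)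

text \<open>The second interval accounts for the arc that a shifted subdivision wraps around.\<close>

lemma emeasure_strip_le:
  assumes "0 < L" "0 < M" "\<theta> \<in> {0, 1 / 2}"
  shows "emeasure lborel (strip L M \<theta> i) \<le> ennreal (2 * (L / M))"
proof -
  let ?l = "L / M"
  let ?I = "\<lambda>k. {(real k - \<theta>) * ?l .. (real k + 1 - \<theta>) * ?l}"
  have l: "0 < ?l" using assms by simp
  have I: "emeasure lborel (?I k) = ennreal ?l" for k
  proof -
    have "(real k + 1 - \<theta>) * c = (real k - \<theta>) * c + c" for c by (simp add: algebra_simps)
    then show ?thesis using l by (simp del: times_divide_eq_right times_divide_eq_left)
  qed
  have "x \<in> ?I i \<union> ?I (i + M)" if "x \<in> strip L M \<theta> i" for x
  proof -
    define k where "k = \<lfloor>x * M / L + \<theta>\<rfloor>"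
    have x: "0 \<le> x" "x \<le> L" and k: "k mod int M = int i" using that by (auto simp: strip_def k_def)
    have "0 \<le> x * M / L" "x * M / L \<le> M" using x assms by (auto simp: field_simps)
    then have "0 \<le> k" "k \<le> int M" using assms unfolding k_def by auto linarith+
    with k have "k = int i \<or> k = int (i + M)" by (cases "k = int M") auto
    moreover have "x \<in> {(real_of_int k - \<theta>) * ?l .. (real_of_int k + 1 - \<theta>) * ?l}"
    proof -
      have "real_of_int k \<le> x * M / L + \<theta>" "x * M / L + \<theta> \<le> real_of_int k + 1"
        unfolding k_def by linarith+
      then have "(real_of_int k - \<theta>) * ?l \<le> (x * M / L) * ?l"
          "(x * M / L) * ?l \<le> (real_of_int k + 1 - \<theta>) * ?l"
        using l by (auto intro!: mult_right_mono simp del: times_divide_eq_right times_divide_eq_left)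
      moreover have "(x * M / L) * ?l = x" using assms by simp
      ultimately show ?thesis by simp
    qed
    ultimately show ?thesis
      by (auto simp del: times_divide_eq_right times_divide_eq_left)
  qed
  then have "strip L M \<theta> i \<subseteq> ?I i \<union> ?I (i + M)" by blast
  then have "emeasure lborel (strip L M \<theta> i) \<le> emeasure lborel (?I i \<union> ?I (i + M))"
    by (rule emeasure_mono) simp
  also have "\<dots> \<le> emeasure lborel (?I i) + emeasure lborel (?I (i + M))"
    by (intro emeasure_subadditive) auto
  also have "\<dots> = ennreal (2 * ?l)"
    unfolding I using l by (subst ennreal_plus[symmetric]) auto
  finally show ?thesis .
qed

lemma measure_cell_le:
  assumes "0 < n" "0 < M" "\<theta> \<in> shifts"
  shows "measure lborel (cell n M \<theta> i) \<le> 4 * real n / (real M)\<^sup>2"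
proof -
  let ?l = "sqrt n / M"
  have "emeasure lborel (cell n M \<theta> i) =
      emeasure lborel (strip (sqrt n) M (fst \<theta>) (fst i)) * emeasure lborel (strip (sqrt n) M (snd \<theta>) (snd i))"
    unfolding cell_def lborel_prod[symmetric] by (intro lborel.emeasure_pair_measure_Times) auto
  also have "\<dots> \<le> ennreal (2 * ?l) * ennreal (2 * ?l)"
    using assms unfolding shifts_def by (intro mult_mono emeasure_strip_le) auto
  also have "\<dots> = ennreal (4 * real n / (real M)\<^sup>2)"
    by (subst ennreal_mult[symmetric]) (auto simp: power2_eq_square)
  finally show ?thesis
    unfolding measure_def by (intro enn2real_leI) auto
qed

lemma measure_square: "measure lborel (square n) = n"
proof -
  have "emeasure lborel (square n) = emeasure lborel {0..sqrt n} * emeasure lborel {0..sqrt n}"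
    unfolding square_def lborel_prod[symmetric] by (intro lborel.emeasure_pair_measure_Times) auto
  also have "\<dots> = ennreal n"
    by (simp add: ennreal_mult[symmetric])
  finally show ?thesis by (simp add: measure_def)
qed

lemma square_borel [measurable]: "square n \<in> sets borel"
  unfolding square_def borel_prod[symmetric] by (intro pair_measureI) auto

section \<open>Routes\<close>

lemma route_eq_map_visited: "route \<A> c n w \<rho> k = map (visited \<A> c n w \<rho>) [0..<Suc k]"
proof (induction k)
  case 0
  show ?case by (simp add: visited_def)
next
  case (Suc k)
  have "route \<A> c n w \<rho> (Suc k) = route \<A> c n w \<rho> k @ [visited \<A> c n w \<rho> (Suc k)]"
    unfolding visited_def by (simp add: Let_def)
  then show ?case by (simp only: Suc upt_Suc_append[OF le0] map_append list.map)
qed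

lemma visited_0: "visited \<A> c n w \<rho> 0 = source w"
  by (simp add: visited_def)

lemma visited_Suc:
  "visited \<A> c n w \<rho> (Suc k) =
     (let vs = map (\<lambda>i. view c n w (visited \<A> c n w \<rho> i)) [0..<Suc k]
      in if visited \<A> c n w \<rho> k = destination w \<or> known_contacts vs = {} then visited \<A> c n w \<rho> k
         else \<A> \<rho> (destination w) vs)"
proof -
  have "map (view c n w) (route \<A> c n w \<rho> k) = map (\<lambda>i. view c n w (visited \<A> c n w \<rho> i)) [0..<Suc k]"
    unfolding route_eq_map_visited map_map comp_def ..
  then show ?thesis
    unfolding visited_def[of _ _ _ _ _ "Suc k"] by (simp add: Let_def flip: visited_def)
qed

lemma visited_Suc_cases:
  assumes "decentralised \<A>"
  shows "visited \<A> c n w \<rho> (Suc k) = visited \<A> c n w \<rho> k \<or>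
    (\<exists>i \<le> k. visited \<A> c n w \<rho> (Suc k) \<in>
       local_contacts c n w (visited \<A> c n w \<rho> i) \<union> shortcut_contacts w (visited \<A> c n w \<rho> i))"
proof -
  define vs where "vs = map (\<lambda>i. view c n w (visited \<A> c n w \<rho> i)) [0..<Suc k]"
  have step: "visited \<A> c n w \<rho> (Suc k) = (if visited \<A> c n w \<rho> k = destination w \<or> known_contacts vs = {}
      then visited \<A> c n w \<rho> k else \<A> \<rho> (destination w) vs)"
    unfolding visited_Suc Let_def vs_def ..
  show ?thesis
  proof (cases "visited \<A> c n w \<rho> k = destination w \<or> known_contacts vs = {}")
    case True
    then show ?thesis unfolding step if_P[OF True] by blast
  next
    case False
    then have "visited \<A> c n w \<rho> (Suc k) = \<A> \<rho> (destination w) vs"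
      unfolding step by (rule if_not_P)
    moreover from False assms have "\<A> \<rho> (destination w) vs \<in> known_contacts vs"
      unfolding decentralised_def by blast
    moreover have "known_contacts vs =
        (\<Union>i \<le> k. local_contacts c n w (visited \<A> c n w \<rho> i) \<union> shortcut_contacts w (visited \<A> c n w \<rho> i))"
      unfolding known_contacts_def vs_def by (auto simp: view_def less_Suc_eq_le simp del: upt_Suc)
    ultimately show ?thesis by auto
  qed
qed

text \<open>These properties of a network hold almost surely, except that source and destination are nodes only
  if there are nodes at all.\<close>

definition regular :: "nat \<Rightarrow> network \<Rightarrow> bool" where
  "regular n w \<longleftrightarrow> inj_on (position w) {..<num_nodes w} \<and> nodes w \<subseteq> square n \<and>
     fst (snd w) < num_nodes w \<and> snd (snd w) < num_nodes w \<and>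
     (\<forall>i j. shortcut w (i, j) \<longrightarrow> i < j \<and> j < num_nodes w)"

text \<open>Shortcuts are recorded at the increasing pair of indices only.\<close>

definition link :: "nat \<Rightarrow> nat \<Rightarrow> nat \<times> nat" where
  "link u v = (min u v, max u v)"

text \<open>At time \<open>k\<close> the route makes its first visit to node \<open>u\<close>, while node \<open>v\<close>, which is near the
  destination, has not been visited. The state of the link between \<open>u\<close> and \<open>v\<close> is left out, and it
  has no influence on the route up to time \<open>k\<close>; hence the link is independent of the event.\<close>

definition exposes ::
    "'r algorithm \<Rightarrow> real \<Rightarrow> nat \<Rightarrow> real \<Rightarrow> network \<Rightarrow> 'r \<Rightarrow> nat \<Rightarrow> nat \<Rightarrow> nat \<Rightarrow> bool" where
  "exposes \<A> c n r w \<rho> k u v \<longleftrightarrow>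
     u < num_nodes w \<and> v < num_nodes w \<and> u \<noteq> v \<and> inj_on (position w) {..<num_nodes w} \<and>
     visited \<A> c n w \<rho> k = position w u \<and>
     (\<forall>i < k. visited \<A> c n w \<rho> i \<noteq> position w u \<and> visited \<A> c n w \<rho> i \<noteq> position w v) \<and>
     torus_dist n (position w v) (destination w) < r"

lemma regular_shortcut_contactsE:
  assumes "regular n w" "z \<in> shortcut_contacts w y"
  obtains u v where "u < num_nodes w" "v < num_nodes w" "u \<noteq> v" "y = position w u" "z = position w v"
    "shortcut w (link u v)"
proof -
  from assms(2) obtain u v where uv: "u < num_nodes w" "v < num_nodes w" "y = position w u"
      "z = position w v" "shortcut w (u, v) \<or> shortcut w (v, u)"
    unfolding shortcut_contacts_def by blast
  moreover from uv(5) assms(1) have "u \<noteq> v" "shortcut w (link u v)"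
    unfolding regular_def link_def by (auto simp: min_def max_def) (meson less_imp_le not_less)+
  ultimately show thesis using that by blast
qed

text \<open>By induction on \<open>k\<close>. The node visited at time \<open>k\<close> is a contact of an earlier one. If the contact is
  local, the distance to the destination drops by less than the local radius. If it is a shortcut
  into the neighbourhood of the destination, then, since no exposed link is present, its inner end had
  been visited before the first visit to its outer end, and the claim holds by induction.\<close>

lemma visited_far_from_destination:
  assumes "decentralised \<A>" and reg: "regular n w" and rad: "0 \<le> local_radius c n"
    and start: "r \<le> torus_dist n (source w) (destination w)"
    and none: "\<And>k u v. k < K \<Longrightarrow> exposes \<A> c n r w \<rho> k u v \<Longrightarrow> \<not> shortcut w (link u v)"
  shows "k \<le> K \<Longrightarrow> visited \<A> c n w \<rho> k \<in> nodes w \<and>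
    r - real k * local_radius c n \<le> torus_dist n (visited \<A> c n w \<rho> k) (destination w)"
proof (induction k rule: less_induct)
  case (less k)
  let ?x = "visited \<A> c n w \<rho>" and ?t = "destination w" and ?R = "local_radius c n"
  have t: "?t \<in> nodes w" and s: "source w \<in> nodes w"
    using reg by (auto simp: regular_def nodes_def source_def destination_def)
  have sq: "nodes w \<subseteq> square n" using reg by (simp add: regular_def)
  show ?case
  proof (cases k)
    case 0
    then show ?thesis using start s by (simp add: visited_0)
  next
    case (Suc l)
    have IH: "?x i \<in> nodes w" "r - real i * ?R \<le> torus_dist n (?x i) ?t" if "i \<le> l" for i
      using less Suc that by auto
    have mono: "r - real k * ?R \<le> r - real i * ?R" if "i \<le> k" for i
      using that rad by (simp add: mult_right_mono)
    from visited_Suc_cases[OF assms(1), of c n w \<rho> l]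
    consider "?x k = ?x l" | i where "i \<le> l" "?x k \<in> local_contacts c n w (?x i)"
      | i where "i \<le> l" "?x k \<in> shortcut_contacts w (?x i)"
      unfolding Suc by blast
    then show ?thesis
    proof cases
      case 1
      then show ?thesis using IH[of l] mono[of l] Suc by auto
    next
      case (2 i)
      then have xk: "?x k \<in> nodes w" "torus_dist n (?x i) (?x k) < ?R"
        by (auto simp: local_contacts_def)
      have "torus_dist n (?x i) ?t \<le> torus_dist n (?x i) (?x k) + torus_dist n (?x k) ?t"
        using xk(1) IH[OF 2(1)] t sq by (intro torus_dist_triangle) auto
      moreover have "r - real k * ?R \<le> r - real i * ?R - ?R"
        using mult_right_mono[of "real i + 1" "real k" ?R] rad 2(1) Suc by (simp add: algebra_simps)
      ultimately show ?thesis using IH(2)[OF 2(1)] xk by linarith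
    next
      case (3 i)
      then obtain u v where uv: "u < num_nodes w" "v < num_nodes w" "u \<noteq> v" "?x i = position w u"
          "?x k = position w v" "shortcut w (link u v)"
        using reg by (elim regular_shortcut_contactsE)
      have node: "?x k \<in> nodes w" using uv by (auto simp: nodes_def)
      have far: "r - real k * ?R \<le> torus_dist n (?x k) ?t" if far: "r \<le> torus_dist n (?x k) ?t"
        using far mono[of 0] by simp
      \<comment> \<open>\<open>i\<close> need not be the first visit to \<open>u\<close>, but only first visits can expose a link.\<close>
      define i' where "i' = (LEAST i'. ?x i' = position w u)"
      have i': "?x i' = position w u" "i' \<le> i" "\<And>j. j < i' \<Longrightarrow> ?x j \<noteq> position w u"
        unfolding i'_def using uv(4) by (auto intro: LeastI Least_le dest: not_less_Least)
      show ?thesis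
      proof (cases "\<exists>j < i'. ?x j = position w v")
        case True
        then obtain j where j: "j < i'" "?x j = ?x k" using uv by auto
        have "j \<le> l" using j i'(2) 3(1) by simp
        then show ?thesis using IH[of j] j mono[of j] Suc by simp
      next
        case False
        have "\<not> exposes \<A> c n r w \<rho> i' u v"
          using none[of i' u v] uv(6) i'(2) 3(1) Suc less.prems by fastforce
        then have "r \<le> torus_dist n (?x k) ?t"
          using uv i' False reg by (auto simp: exposes_def regular_def)
        with far node show ?thesis by blast
      qed
    qed
  qed
qed

lemma far_imp_hops:
  assumes "decentralised \<A>" "regular n w" "0 \<le> local_radius c n"
    and "r \<le> torus_dist n (source w) (destination w)"
    and "\<And>k u v. k < K \<Longrightarrow> exposes \<A> c n r w \<rho> k u v \<Longrightarrow> \<not> shortcut w (link u v)"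
    and r: "real K * local_radius c n < r" and "k \<le> K"
  shows "visited \<A> c n w \<rho> k \<noteq> destination w"
proof
  assume "visited \<A> c n w \<rho> k = destination w"
  with visited_far_from_destination[OF assms(1-4) _ \<open>k \<le> K\<close>, of \<rho>] assms(5)
  have "r \<le> real k * local_radius c n" by simp
  also have "\<dots> \<le> real K * local_radius c n" using assms by (intro mult_right_mono) auto
  finally show False using r by simp
qed

definition set_link :: "nat \<times> nat \<Rightarrow> bool \<Rightarrow> network \<Rightarrow> network" where
  "set_link e b w = ((num_nodes w, position w, (shortcut w)(e := b)), snd w)"

lemma set_link_simps [simp]:
  "num_nodes (set_link e b w) = num_nodes w" "position (set_link e b w) = position w"
  "shortcut (set_link e b w) = (shortcut w)(e := b)" "snd (set_link e b w) = snd w"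
  "nodes (set_link e b w) = nodes w" "source (set_link e b w) = source w"
  "destination (set_link e b w) = destination w" "set_link e b' (set_link e b w) = set_link e b' w"
  by (auto simp: set_link_def num_nodes_def position_def shortcut_def nodes_def source_def destination_def)

lemma set_link_same [simp]: "set_link e (shortcut w e) w = w"
  by (simp add: set_link_def num_nodes_def position_def shortcut_def)

lemma view_set_link:
  assumes "z \<noteq> position w u" "z \<noteq> position w v"
  shows "view c n (set_link (link u v) b w) z = view c n w z"
proof -
  have "shortcut_contacts (set_link (link u v) b w) z = shortcut_contacts w z"
  proof -
    have other: "(i, j) \<noteq> link u v \<and> (j, i) \<noteq> link u v" if "position w i = z" for i j
      using that assms by (auto simp: link_def min_def)
    show ?thesis unfolding shortcut_contacts_def set_link_simps
      by (intro Collect_cong ex_cong1) (use other in force)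
  qed
  then show ?thesis by (simp add: view_def local_contacts_def)
qed

text \<open>The routing decision at each time depends on the views of the nodes visited so far, and the link
  between \<open>u\<close> and \<open>v\<close> shows only in the views of \<open>u\<close> and \<open>v\<close>.\<close>

lemma visited_set_link:
  assumes "\<forall>i < k. visited \<A> c n w \<rho> i \<noteq> position w u \<and> visited \<A> c n w \<rho> i \<noteq> position w v"
  shows "i \<le> k \<Longrightarrow> visited \<A> c n (set_link (link u v) b w) \<rho> i = visited \<A> c n w \<rho> i"
proof (induction i rule: less_induct)
  case (less i)
  show ?case
  proof (cases i)
    case 0
    then show ?thesis by (simp add: visited_0)
  next
    case (Suc l)
    have eq: "visited \<A> c n (set_link (link u v) b w) \<rho> j = visited \<A> c n w \<rho> j" if "j < Suc l" for j
      using less that Suc by simp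
    have "map (\<lambda>j. view c n (set_link (link u v) b w) (visited \<A> c n (set_link (link u v) b w) \<rho> j)) [0..<Suc l]
        = map (\<lambda>j. view c n w (visited \<A> c n w \<rho> j)) [0..<Suc l]"
      using assms less.prems Suc by (intro map_cong refl) (auto simp: eq view_set_link simp del: upt_Suc)
    then show ?thesis unfolding Suc visited_Suc by (simp only: eq lessI set_link_simps)
  qed
qed

lemma exposes_set_link:
  "exposes \<A> c n r (set_link (link u v) b w) \<rho> k u v \<longleftrightarrow> exposes \<A> c n r w \<rho> k u v"
proof -
  have *: "exposes \<A> c n r (set_link (link u v) b w) \<rho> k u v" if "exposes \<A> c n r w \<rho> k u v" for b w
  proof -
    have "\<forall>i \<le> k. visited \<A> c n (set_link (link u v) b w) \<rho> i = visited \<A> c n w \<rho> i"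
      using that visited_set_link[of k \<A> c n w \<rho> u v _ b] unfolding exposes_def by blast
    with that show ?thesis unfolding exposes_def set_link_simps by simp
  qed
  show ?thesis
    using *[of w b] *[of "set_link (link u v) b w" "shortcut w (link u v)"]
    unfolding set_link_simps set_link_same by blast
qed

section \<open>Numbers of nodes\<close>

lemma nn_integral_nat_valued:
  assumes [measurable]: "X \<in> M \<rightarrow>\<^sub>M count_space UNIV"
  shows "(\<integral>\<^sup>+w. f (X w :: nat) \<partial>M) = (\<Sum>k. f k * emeasure M {w \<in> space M. X w = k})"
proof -
  have "(\<integral>\<^sup>+w. f (X w) \<partial>M) = (\<integral>\<^sup>+w. (\<Sum>k. f k * indicator {w \<in> space M. X w = k} w) \<partial>M)"
  proof (intro nn_integral_cong)
    fix w assume "w \<in> space M"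
    then show "f (X w) = (\<Sum>k. f k * indicator {w \<in> space M. X w = k} w)"
      by (subst suminf_finite[of "{X w}"]) auto
  qed
  also have "\<dots> = (\<Sum>k. \<integral>\<^sup>+w. f k * indicator {w \<in> space M. X w = k} w \<partial>M)"
    by (intro nn_integral_suminf) measurable
  also have "\<dots> = (\<Sum>k. f k * emeasure M {w \<in> space M. X w = k})"
    by (intro suminf_cong nn_integral_cmult_indicator) measurable
  finally show ?thesis .
qed

text \<open>The factors \<open>k\<close> are absorbed into the factorial by an index shift.\<close>

lemma poisson_moment_sums:
  fixes l :: real
  shows "(\<lambda>k. real k * (exp (- l) * l ^ k / fact k)) sums l"
    and "(\<lambda>k. (real k)\<^sup>2 * (exp (- l) * l ^ k / fact k)) sums (l + l\<^sup>2)"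
proof -
  have 0: "(\<lambda>k. exp (- l) * l ^ k / fact k) sums 1"
    using sums_mult[OF exp_converges[of l], of "exp (- l)"]
    by (simp add: scaleR_conv_of_real field_simps flip: exp_add)
  have shift: "real (Suc k) * (exp (- l) * l ^ Suc k / fact (Suc k)) = l * (exp (- l) * l ^ k / fact k)" for k
    unfolding fact_Suc power_Suc by (simp del: of_nat_Suc)
  have "(\<lambda>k. real (Suc k) * (exp (- l) * l ^ Suc k / fact (Suc k))) sums l"
    unfolding shift using sums_mult[OF 0, of l] by simp
  then show 1: "(\<lambda>k. real k * (exp (- l) * l ^ k / fact k)) sums l"
    using sums_Suc_iff[of "\<lambda>k. real k * (exp (- l) * l ^ k / fact k)" l] by simp
  have "(real (Suc k))\<^sup>2 * (exp (- l) * l ^ Suc k / fact (Suc k)) =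
      l * (real k * (exp (- l) * l ^ k / fact k) + exp (- l) * l ^ k / fact k)" for k
    using arg_cong[OF shift[of k], of "\<lambda>x. real (Suc k) * x"]
    by (simp add: power2_eq_square algebra_simps add_divide_distrib del: fact_Suc power_Suc)
  moreover have "(\<lambda>k. l * (real k * (exp (- l) * l ^ k / fact k) + exp (- l) * l ^ k / fact k)) sums (l * (l + 1))"
    by (intro sums_mult sums_add 0 1)
  ultimately have "(\<lambda>k. (real (Suc k))\<^sup>2 * (exp (- l) * l ^ Suc k / fact (Suc k))) sums (l + l\<^sup>2)"
    by (simp only: power2_eq_square) (simp add: algebra_simps)
  then show "(\<lambda>k. (real k)\<^sup>2 * (exp (- l) * l ^ k / fact k)) sums (l + l\<^sup>2)"
    using sums_Suc_iff[of "\<lambda>k. (real k)\<^sup>2 * (exp (- l) * l ^ k / fact k)" "l + l\<^sup>2"] by simp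
qed

text \<open>Ordered pairs, including the pairs of equal indices.\<close>

definition close_pairs :: "nat \<Rightarrow> real \<Rightarrow> network \<Rightarrow> nat" where
  "close_pairs n r w = card {(i, j). i < num_nodes w \<and> j < num_nodes w \<and>
     torus_dist n (position w i) (position w j) < r}"

text \<open>Every close pair lies in the square of the node set of a common cell. Bounding pairs by squares of
  cell counts is what reduces the later expectation to second moments.\<close>

lemma close_pairs_le_sum_cells:
  assumes inj: "inj_on (position w) {..<num_nodes w}" and sq: "nodes w \<subseteq> square n"
    and nM: "0 < n" "0 < M" and r: "r \<le> sqrt n / (2 * real M)"
  shows "close_pairs n r w \<le>
    (\<Sum>\<theta> \<in> shifts. \<Sum>i \<in> {..<M} \<times> {..<M}. (card (nodes w \<inter> cell n M \<theta> i))\<^sup>2)"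
proof -
  let ?P = "{(i, j). i < num_nodes w \<and> j < num_nodes w \<and> torus_dist n (position w i) (position w j) < r}"
  let ?C = "\<lambda>\<theta> i. nodes w \<inter> cell n M \<theta> i"
  let ?U = "\<Union>\<theta> \<in> shifts. \<Union>i \<in> {..<M} \<times> {..<M}. ?C \<theta> i \<times> ?C \<theta> i"
  have fin: "finite (nodes w)" by (simp add: nodes_def)
  have "map_prod (position w) (position w) p \<in> ?U" if p: "p \<in> ?P" for p
  proof -
    obtain i j where ij: "p = (i, j)" "i < num_nodes w" "j < num_nodes w"
        "torus_dist n (position w i) (position w j) < r" using p by auto
    then have "position w i \<in> nodes w" "position w j \<in> nodes w" by (auto simp: nodes_def)
    moreover from this sq have "position w i \<in> square n" "position w j \<in> square n" by auto
    from common_cell[OF nM this less_le_trans[OF ij(4) r]]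
    have "\<exists>\<theta> \<in> shifts. \<exists>k \<in> {..<M} \<times> {..<M}.
        position w i \<in> cell n M \<theta> k \<and> position w j \<in> cell n M \<theta> k" .
    ultimately show ?thesis unfolding ij(1) map_prod_simp by blast
  qed
  then have "map_prod (position w) (position w) ` ?P \<subseteq> ?U" by (rule image_subsetI)
  moreover have "inj_on (map_prod (position w) (position w)) ?P"
    by (rule inj_on_subset[OF map_prod_inj_on[OF inj inj]]) auto
  moreover have "finite ?U"
    using fin by (intro finite_UN_I finite_cartesian_product finite_Int finite_shifts finite_lessThan disjI1)
  ultimately have "card ?P \<le> card ?U" using card_inj_on_le by blast
  also have "\<dots> \<le> (\<Sum>\<theta> \<in> shifts. card (\<Union>i \<in> {..<M} \<times> {..<M}. ?C \<theta> i \<times> ?C \<theta> i))"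
    by (rule card_UN_le) (rule finite_shifts)
  also have "\<dots> \<le> (\<Sum>\<theta> \<in> shifts. \<Sum>i \<in> {..<M} \<times> {..<M}. card (?C \<theta> i \<times> ?C \<theta> i))"
    by (intro sum_mono card_UN_le finite_cartesian_product finite_lessThan)
  finally show ?thesis by (simp add: close_pairs_def card_cartesian_product power2_eq_square)
qed

locale small_world =
  fixes c \<alpha> a :: real and n :: nat and W :: "network measure"
  assumes small_world: "poisson_small_world c \<alpha> a n W"
begin

sublocale prob_space W
  using small_world by (simp add: poisson_small_world_def)

lemma sets_W: "sets W = sets network_space"
  using small_world by (simp add: poisson_small_world_def)

lemma AE_nodes: "AE w in W. inj_on (position w) {..<num_nodes w} \<and> nodes w \<subseteq> square n"
proof -
  have "AE w in W. inj_on (position w) {..<num_nodes w}"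
      "AE w in W. finite (nodes w) \<and> nodes w \<subseteq> square n"
    using small_world by (auto simp: poisson_small_world_def poisson_process_def)
  then show ?thesis by eventually_elim blast
qed

lemma node_count_measurable:
  assumes "B \<in> sets borel" "B \<subseteq> square n"
  shows "(\<lambda>w. card (nodes w \<inter> B)) \<in> W \<rightarrow>\<^sub>M count_space UNIV"
  using small_world assms by (auto simp: poisson_small_world_def poisson_process_def)

lemma node_count_moments:
  assumes "B \<in> sets borel" "B \<subseteq> square n"
  defines "\<mu> \<equiv> measure lborel B"
  shows "(\<integral>\<^sup>+w. ennreal (real (card (nodes w \<inter> B))) \<partial>W) = ennreal \<mu>"
    and "(\<integral>\<^sup>+w. ennreal ((real (card (nodes w \<inter> B)))\<^sup>2) \<partial>W) = ennreal (\<mu> + \<mu>\<^sup>2)"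
proof -
  let ?X = "\<lambda>w. card (nodes w \<inter> B)"
  have "measure W {w \<in> space W. ?X w = k} = exp (- \<mu>) * \<mu> ^ k / fact k" for k
    using small_world assms by (auto simp: poisson_small_world_def poisson_process_def)
  then have law: "emeasure W {w \<in> space W. ?X w = k} = ennreal (exp (- \<mu>) * \<mu> ^ k / fact k)" for k
    by (simp add: emeasure_eq_measure)
  have "0 \<le> \<mu>" by (simp add: \<mu>_def)
  have *: "(\<integral>\<^sup>+w. ennreal (f (?X w)) \<partial>W) = ennreal s"
    if f: "\<And>k. 0 \<le> f k" "(\<lambda>k. f k * (exp (- \<mu>) * \<mu> ^ k / fact k)) sums s" for f s
  proof -
    have "(\<integral>\<^sup>+w. ennreal (f (?X w)) \<partial>W) = (\<Sum>k. ennreal (f k) * ennreal (exp (- \<mu>) * \<mu> ^ k / fact k))"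
      by (subst nn_integral_nat_valued[OF node_count_measurable[OF assms(1,2)]]) (simp only: law)
    also have "\<dots> = (\<Sum>k. ennreal (f k * (exp (- \<mu>) * \<mu> ^ k / fact k)))"
      using f(1) by (intro suminf_cong ennreal_mult'[symmetric]) auto
    also have "\<dots> = ennreal s"
      using f \<open>0 \<le> \<mu>\<close> by (subst suminf_ennreal_eq) auto
    finally show ?thesis .
  qed
  show "(\<integral>\<^sup>+w. ennreal (real (?X w)) \<partial>W) = ennreal \<mu>"
    by (rule *[OF _ poisson_moment_sums(1)]) simp
  show "(\<integral>\<^sup>+w. ennreal ((real (?X w))\<^sup>2) \<partial>W) = ennreal (\<mu> + \<mu>\<^sup>2)"
    by (rule *[OF _ poisson_moment_sums(2)]) simp
qed

lemma expected_close_pairs_le_cells: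
  assumes nM: "0 < n" "0 < M" and r: "r \<le> sqrt n / (2 * real M)"
  shows "(\<integral>\<^sup>+w. ennreal (real (close_pairs n r w)) \<partial>W) \<le> ennreal (16 * real n + 64 * (real n)\<^sup>2 / (real M)\<^sup>2)"
proof -
  let ?I = "{..<M} \<times> {..<M}"
  let ?m = "4 * real n / (real M)\<^sup>2"
  have "(\<integral>\<^sup>+w. ennreal (real (close_pairs n r w)) \<partial>W) \<le>
      (\<integral>\<^sup>+w. (\<Sum>\<theta> \<in> shifts. \<Sum>i \<in> ?I. ennreal ((real (card (nodes w \<inter> cell n M \<theta> i)))\<^sup>2)) \<partial>W)"
  proof (rule nn_integral_mono_AE, use AE_nodes in eventually_elim)
    case (elim w)
    then have "real (close_pairs n r w) \<le>
        real (\<Sum>\<theta> \<in> shifts. \<Sum>i \<in> ?I. (card (nodes w \<inter> cell n M \<theta> i))\<^sup>2)"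
      using nM r by (intro of_nat_mono close_pairs_le_sum_cells) auto
    then have "ennreal (real (close_pairs n r w)) \<le>
        ennreal (\<Sum>\<theta> \<in> shifts. \<Sum>i \<in> ?I. (real (card (nodes w \<inter> cell n M \<theta> i)))\<^sup>2)"
      by (intro ennreal_leI) (simp only: of_nat_sum of_nat_power)
    also have "\<dots> = (\<Sum>\<theta> \<in> shifts. \<Sum>i \<in> ?I. ennreal ((real (card (nodes w \<inter> cell n M \<theta> i)))\<^sup>2))"
      by (simp only: sum_ennreal sum_nonneg zero_le_power2)
    finally show ?case .
  qed
  also have "\<dots> = (\<Sum>\<theta> \<in> shifts. \<integral>\<^sup>+w. (\<Sum>i \<in> ?I. ennreal ((real (card (nodes w \<inter> cell n M \<theta> i)))\<^sup>2)) \<partial>W)"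
    using node_count_measurable[OF cell_borel cell_subset]
    by (intro nn_integral_sum borel_measurable_sum) measurable
  also have "\<dots> = (\<Sum>\<theta> \<in> shifts. \<Sum>i \<in> ?I. \<integral>\<^sup>+w. ennreal ((real (card (nodes w \<inter> cell n M \<theta> i)))\<^sup>2) \<partial>W)"
    using node_count_measurable[OF cell_borel cell_subset]
    by (intro sum.cong refl nn_integral_sum) measurable
  also have "\<dots> \<le> (\<Sum>\<theta> \<in> shifts. \<Sum>i \<in> ?I. ennreal (?m + ?m\<^sup>2))"
    unfolding node_count_moments(2)[OF cell_borel cell_subset] using nM
    by (intro sum_mono ennreal_leI add_mono power_mono measure_cell_le) simp_all
  also have "\<dots> = ennreal (\<Sum>\<theta> \<in> shifts. \<Sum>i \<in> ?I. (?m + ?m\<^sup>2))"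
    by (subst sum_ennreal[symmetric], simp add: sum_nonneg, subst sum_ennreal[symmetric]) auto
  also have "(\<Sum>\<theta> \<in> shifts. \<Sum>i \<in> ?I. (?m + ?m\<^sup>2)) = 16 * real n + 64 * (real n)\<^sup>2 / (real M)\<^sup>2"
    using nM by (simp add: card_cartesian_product card_shifts field_simps power2_eq_square)
  finally show ?thesis .
qed

text \<open>The finest subdivision whose cells still have side at least \<open>2 r\<close> is used; its cells have side at
  most \<open>4 r\<close>.\<close>

lemma expected_close_pairs:
  assumes r: "1 \<le> r" "2 * r \<le> sqrt n"
  shows "(\<integral>\<^sup>+w. ennreal (real (close_pairs n r w)) \<partial>W) \<le> ennreal (1040 * real n * r\<^sup>2)"
proof -
  define x where "x = sqrt n / (2 * r)"
  define M where "M = nat \<lfloor>x\<rfloor>"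
  have n: "0 < n" using r by (intro Nat.gr0I) auto
  have x: "1 \<le> x" using r by (simp add: x_def field_simps)
  then have M_eq: "real M = of_int \<lfloor>x\<rfloor>" by (simp add: M_def)
  have "1 \<le> real_of_int \<lfloor>x\<rfloor>" "real_of_int \<lfloor>x\<rfloor> \<le> x" "x < real_of_int \<lfloor>x\<rfloor> + 1"
    using x by auto
  then have M: "0 < M" "real M \<le> x" "x / 2 \<le> real M" unfolding M_eq[symmetric] by auto
  have "r = sqrt n / (2 * x)" using r n by (simp add: x_def)
  also have "\<dots> \<le> sqrt n / (2 * real M)" using M x by (intro divide_left_mono) auto
  finally have "(\<integral>\<^sup>+w. ennreal (real (close_pairs n r w)) \<partial>W) \<le> ennreal (16 * real n + 64 * (real n)\<^sup>2 / (real M)\<^sup>2)"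
    by (intro expected_close_pairs_le_cells n M)
  also have "\<dots> \<le> ennreal (16 * real n + 64 * (real n)\<^sup>2 / (x / 2)\<^sup>2)"
    using M x by (intro ennreal_leI add_mono divide_left_mono power_mono mult_pos_pos) auto
  also have "64 * (real n)\<^sup>2 / (x / 2)\<^sup>2 = 1024 * real n * r\<^sup>2"
    using r n by (simp add: x_def power_divide power_mult_distrib) (simp add: power2_eq_square)
  also have "16 * real n + 1024 * real n * r\<^sup>2 \<le> 1040 * real n * r\<^sup>2"
    using mult_left_mono[of 1 "r\<^sup>2" "16 * real n"] r by simp
  finally show ?thesis by (simp add: ennreal_leI)
qed

lemma num_nodes_eq: "AE w in W. card (nodes w \<inter> square n) = num_nodes w"
  using AE_nodes by eventually_elim (simp add: Int_absorb2 nodes_def card_image)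

lemma num_nodes_moments:
  shows "(\<integral>\<^sup>+w. ennreal (real (num_nodes w)) \<partial>W) = ennreal n"
    and "(\<integral>\<^sup>+w. ennreal ((real (num_nodes w))\<^sup>2) \<partial>W) = ennreal (n + (real n)\<^sup>2)"
  unfolding node_count_moments[OF square_borel subset_refl, unfolded measure_square, symmetric]
  using num_nodes_eq by (auto intro!: nn_integral_cong_AE elim: eventually_mono)

end

section \<open>Conditional laws\<close>

lemma nn_integral_weights_cong:
  assumes [measurable]: "X \<in> M \<rightarrow>\<^sub>M N" "u \<in> borel_measurable M" "v \<in> borel_measurable M" "h \<in> borel_measurable N"
    and eq: "\<And>A. A \<in> sets N \<Longrightarrow>
      (\<integral>\<^sup>+w. u w * indicator A (X w) \<partial>M) = (\<integral>\<^sup>+w. v w * indicator A (X w) \<partial>M)"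
  shows "(\<integral>\<^sup>+w. u w * h (X w) \<partial>M) = (\<integral>\<^sup>+w. v w * h (X w) \<partial>M)"
proof -
  have push: "(\<integral>\<^sup>+w. t w * g (X w) \<partial>M) = (\<integral>\<^sup>+x. g x \<partial>distr (density M t) N X)"
    if [measurable]: "t \<in> borel_measurable M" "g \<in> borel_measurable N" for t g
    by (subst nn_integral_distr) (auto simp: nn_integral_density)
  have "distr (density M u) N X = distr (density M v) N X"
  proof (rule measure_eqI)
    fix A assume "A \<in> sets (distr (density M u) N X)"
    then have [measurable]: "A \<in> sets N" by simp
    have "emeasure (distr (density M t) N X) A = (\<integral>\<^sup>+w. t w * indicator A (X w) \<partial>M)"
      if [measurable]: "t \<in> borel_measurable M" for t
      by (subst push) auto
    then show "emeasure (distr (density M u) N X) A = emeasure (distr (density M v) N X) A"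
      using eq by simp
  qed simp
  then show ?thesis by (simp add: push)
qed

lemma nn_integral_split_nat:
  fixes Y :: "'w \<Rightarrow> nat"
  assumes [measurable]: "Y \<in> M \<rightarrow>\<^sub>M count_space UNIV" "g \<in> borel_measurable M"
  shows "(\<integral>\<^sup>+w. g w \<partial>M) = (\<Sum>m. \<integral>\<^sup>+w. g w * indicator {w \<in> space M. Y w = m} w \<partial>M)"
proof -
  have "(\<integral>\<^sup>+w. g w \<partial>M) = (\<integral>\<^sup>+w. (\<Sum>m. g w * indicator {w \<in> space M. Y w = m} w) \<partial>M)"
  proof (intro nn_integral_cong)
    fix w assume "w \<in> space M"
    then show "g w = (\<Sum>m. g w * indicator {w \<in> space M. Y w = m} w)"
      by (subst suminf_finite[of "{Y w}"]) auto
  qed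
  also have "\<dots> = (\<Sum>m. \<integral>\<^sup>+w. g w * indicator {w \<in> space M. Y w = m} w \<partial>M)"
    by (intro nn_integral_suminf) measurable
  finally show ?thesis .
qed

text \<open>Integrating out a discrete component \<open>Z\<close> against its conditional law \<open>\<kappa>\<close> given \<open>Y\<close> and \<open>X\<close>. The law is
  given only on the part of the space where \<open>Y = m\<close>, and the alternative in \<open>total\<close> admits
  exceptional values \<open>m\<close> at which \<open>\<kappa>\<close> carries no mass, provided that the integrand vanishes there. This
  occurs for the endpoints of a network without nodes.\<close>

lemma nn_integral_conditional_law:
  fixes Y :: "'w \<Rightarrow> nat" and Z :: "'w \<Rightarrow> 'z"
  assumes "finite_measure M"
    and X [measurable]: "X \<in> M \<rightarrow>\<^sub>M N" and Y [measurable]: "Y \<in> M \<rightarrow>\<^sub>M count_space UNIV"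
    and Z [measurable]: "\<And>z. {w \<in> space M. Z w = z} \<in> sets M"
    and fin: "\<And>m. finite (I m)"
    and H [measurable]: "\<And>m z. H m z \<in> borel_measurable N"
    and \<kappa> [measurable]: "\<And>m z. \<kappa> m z \<in> borel_measurable M"
    and law: "\<And>m z A. z \<in> I m \<Longrightarrow> A \<in> sets N \<Longrightarrow>
      emeasure M {w \<in> space M. Y w = m \<and> X w \<in> A \<and> Z w = z} =
      (\<integral>\<^sup>+w. \<kappa> m z w * indicator {w \<in> space M. Y w = m \<and> X w \<in> A} w \<partial>M)"
    and total: "\<And>m. (\<forall>w. (\<Sum>z \<in> I m. \<kappa> m z w) = 1) \<or> (\<forall>z x. H m z x = 0)"
    and HM: "(\<lambda>w. H (Y w) (Z w) (X w)) \<in> borel_measurable M"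
  shows "(\<integral>\<^sup>+w. H (Y w) (Z w) (X w) \<partial>M) = (\<integral>\<^sup>+w. (\<Sum>z \<in> I (Y w). \<kappa> (Y w) z w * H (Y w) z (X w)) \<partial>M)"
proof -
  interpret finite_measure M by fact
  let ?B = "\<lambda>m. {w \<in> space M. Y w = m}" and ?D = "\<lambda>m z. {w \<in> space M. Y w = m \<and> Z w = z}"
  have D [measurable]: "?D m z \<in> sets M" for m z
  proof -
    have "?D m z = ?B m \<inter> {w \<in> space M. Z w = z}" by auto
    then show ?thesis by simp
  qed
  have cond: "(\<integral>\<^sup>+w. indicator (?D m z) w * h (X w) \<partial>M) = (\<integral>\<^sup>+w. (\<kappa> m z w * indicator (?B m) w) * h (X w) \<partial>M)"
    if z: "z \<in> I m" and [measurable]: "h \<in> borel_measurable N" for m z h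
  proof (rule nn_integral_weights_cong[where N = N])
    fix A assume [measurable]: "A \<in> sets N"
    have "(\<integral>\<^sup>+w. indicator (?D m z) w * indicator A (X w) \<partial>M) =
        (\<integral>\<^sup>+w. indicator {w \<in> space M. Y w = m \<and> X w \<in> A \<and> Z w = z} w \<partial>M)"
      by (intro nn_integral_cong) (auto split: split_indicator)
    also have "\<dots> = emeasure M {w \<in> space M. Y w = m \<and> X w \<in> A \<and> Z w = z}"
    proof (intro nn_integral_indicator)
      have "{w \<in> space M. Y w = m \<and> X w \<in> A \<and> Z w = z} = ?D m z \<inter> (X -` A \<inter> space M)" by auto
      then show "{w \<in> space M. Y w = m \<and> X w \<in> A \<and> Z w = z} \<in> sets M" by simp
    qed
    also have "\<dots> = (\<integral>\<^sup>+w. \<kappa> m z w * indicator (?B m) w * indicator A (X w) \<partial>M)"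
      unfolding law[OF z \<open>A \<in> sets N\<close>] by (intro nn_integral_cong) (auto split: split_indicator)
    finally show "(\<integral>\<^sup>+w. indicator (?D m z) w * indicator A (X w) \<partial>M) =
        (\<integral>\<^sup>+w. \<kappa> m z w * indicator (?B m) w * indicator A (X w) \<partial>M)" .
  qed measurable
  have split: "(\<integral>\<^sup>+w. H (Y w) (Z w) (X w) * indicator (?B m) w \<partial>M) =
      (\<integral>\<^sup>+w. (\<Sum>z \<in> I m. indicator (?D m z) w * H m z (X w)) \<partial>M)" for m
  proof (cases "\<forall>z x. H m z x = 0")
    case True
    then have 0: "H (Y w) (Z w) (X w) * indicator (?B m) w = 0" for w
      by (cases "Y w = m") auto
    show ?thesis unfolding 0 using True by simp
  next
    case False
    then have tot: "(\<Sum>z \<in> I m. \<kappa> m z w) = 1" for w using total[of m] by blast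
    have "emeasure M (\<Union>z \<in> I m. ?D m z) = (\<Sum>z \<in> I m. emeasure M (?D m z))"
      using fin[of m] by (intro sum_emeasure[symmetric]) (auto simp: disjoint_family_on_def)
    also have "\<dots> = (\<Sum>z \<in> I m. \<integral>\<^sup>+w. \<kappa> m z w * indicator (?B m) w \<partial>M)"
      using cond[of _ m "\<lambda>_. 1"] by (intro sum.cong) auto
    also have "\<dots> = (\<integral>\<^sup>+w. (\<Sum>z \<in> I m. \<kappa> m z w * indicator (?B m) w) \<partial>M)"
      by (intro nn_integral_sum[symmetric]) measurable
    also have "\<dots> = emeasure M (?B m)"
      by (simp add: sum_distrib_right[symmetric] tot)
    finally have "emeasure M (?B m - (\<Union>z \<in> I m. ?D m z)) = 0"
      using fin[of m] by (subst emeasure_Diff) (auto simp: emeasure_finite)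
    then have "AE w in M. w \<notin> ?B m - (\<Union>z \<in> I m. ?D m z)"
      using fin[of m] D by (intro AE_not_in null_setsI sets.Diff sets.finite_UN) auto
    then have "AE w in M. H (Y w) (Z w) (X w) * indicator (?B m) w =
        (\<Sum>z \<in> I m. indicator (?D m z) w * H m z (X w))"
    proof eventually_elim
      case (elim w)
      show ?case
      proof (cases "w \<in> ?B m")
        case True
        with elim have w: "Z w \<in> I m" "Y w = m" "w \<in> space M" by auto
        have "(\<Sum>z \<in> I m. indicator (?D m z) w * H m z (X w)) = (\<Sum>z \<in> I m. if z = Z w then H m z (X w) else 0)"
          using w by (intro sum.cong) auto
        also have "\<dots> = H m (Z w) (X w)" using w fin by simp
        finally show ?thesis using w by simp
      next
        case False
        then show ?thesis by (auto intro!: sum.neutral[symmetric] split: split_indicator)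
      qed
    qed
    then show ?thesis by (rule nn_integral_cong_AE)
  qed
  have "(\<integral>\<^sup>+w. H (Y w) (Z w) (X w) \<partial>M) = (\<Sum>m. \<integral>\<^sup>+w. H (Y w) (Z w) (X w) * indicator (?B m) w \<partial>M)"
    by (rule nn_integral_split_nat[OF Y HM])
  also have "\<dots> = (\<Sum>m. \<Sum>z \<in> I m. \<integral>\<^sup>+w. indicator (?D m z) w * H m z (X w) \<partial>M)"
    unfolding split by (intro suminf_cong nn_integral_sum) measurable
  also have "\<dots> = (\<Sum>m. \<Sum>z \<in> I m. \<integral>\<^sup>+w. (\<kappa> m z w * indicator (?B m) w) * H m z (X w) \<partial>M)"
    by (intro suminf_cong sum.cong refl cond) auto
  also have "\<dots> = (\<Sum>m. \<integral>\<^sup>+w. (\<Sum>z \<in> I m. (\<kappa> m z w * indicator (?B m) w) * H m z (X w)) \<partial>M)"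
    by (intro suminf_cong nn_integral_sum[symmetric]) measurable
  also have "\<dots> = (\<Sum>m. \<integral>\<^sup>+w. (\<Sum>z \<in> I (Y w). \<kappa> (Y w) z w * H (Y w) z (X w)) * indicator (?B m) w \<partial>M)"
    by (intro suminf_cong nn_integral_cong) (auto split: split_indicator)
  also have "\<dots> = (\<integral>\<^sup>+w. (\<Sum>z \<in> I (Y w). \<kappa> (Y w) z w * H (Y w) z (X w)) \<partial>M)"
  proof (rule nn_integral_split_nat[symmetric, OF Y])
    show "(\<lambda>w. \<Sum>z \<in> I (Y w). \<kappa> (Y w) z w * H (Y w) z (X w)) \<in> borel_measurable M"
      by (rule measurable_compose_countable[OF _ Y]) measurable
  qed
  finally show ?thesis .
qed

section \<open>The law of the shortcuts\<close>

definition pairs :: "nat \<Rightarrow> (nat \<times> nat) set" where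
  "pairs m = {(i, j). i < j \<and> j < m}"

definition link_sets :: "nat \<Rightarrow> (nat \<times> nat \<Rightarrow> bool) set" where
  "link_sets m = {f. \<forall>e. f e \<longrightarrow> e \<in> pairs m}"

lemma finite_pairs [simp]: "finite (pairs m)"
  by (rule finite_subset[of _ "{..<m} \<times> {..<m}"]) (auto simp: pairs_def)

lemma finite_link_sets [simp]: "finite (link_sets m)"
proof (rule finite_subset)
  show "link_sets m \<subseteq> (\<lambda>S e. e \<in> S) ` Pow (pairs m)"
  proof
    fix f assume "f \<in> link_sets m"
    then have "{e. f e} \<in> Pow (pairs m)" by (auto simp: link_sets_def)
    then have "(\<lambda>e. e \<in> {e. f e}) \<in> (\<lambda>S e. e \<in> S) ` Pow (pairs m)" by (rule imageI)
    then show "f \<in> (\<lambda>S e. e \<in> S) ` Pow (pairs m)" by simp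
  qed
  show "finite ((\<lambda>S e. e \<in> S) ` Pow (pairs m))"
    by (intro finite_imageI finite_Pow_iff[THEN iffD2] finite_pairs)
qed

text \<open>Assigning probability 0 to the pairs within the local radius makes the shortcuts a product over all
  pairs of nodes, so that the index set of the product no longer depends on the positions. The lower
  bound 0 is there because \<open>bernoulli_pmf\<close> truncates its parameter if \<open>a\<close> is negative.\<close>

definition link_prob :: "real \<Rightarrow> real \<Rightarrow> real \<Rightarrow> nat \<Rightarrow> (nat \<Rightarrow> point) \<Rightarrow> nat \<times> nat \<Rightarrow> real" where
  "link_prob c \<alpha> a n x e =
     (if local_radius c n < torus_dist n (x (fst e)) (x (snd e))
      then max 0 (min (a * torus_dist n (x (fst e)) (x (snd e)) powr - \<alpha>) 1) else 0)"

lemma link_prob_bounds: "0 \<le> link_prob c \<alpha> a n x e" "link_prob c \<alpha> a n x e \<le> 1"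
  by (auto simp: link_prob_def)

context
begin

(* Provides the transfer rules for probability mass functions. *)
interpretation pmf_as_function .

lemma pmf_bernoulli_clamp:
  assumes "p \<le> 1"
  shows "pmf (bernoulli_pmf p) b = (if b then max 0 p else 1 - max 0 p)"
proof -
  have "pmf (bernoulli_pmf p) b = (if b then min 1 (max 0 p) else 1 - min 1 (max 0 p))"
    by transfer simp
  with assms show ?thesis by simp
qed

end

lemma pmf_shortcut_pmf:
  "pmf (shortcut_pmf c \<alpha> a n m x) f =
     (if f \<in> link_sets m
      then \<Prod>e \<in> pairs m. if f e then link_prob c \<alpha> a n x e else 1 - link_prob c \<alpha> a n x e else 0)"
proof -
  let ?A = "{(i, j). i < j \<and> j < m \<and> local_radius c n < torus_dist n (x i) (x j)}"
  let ?l = "\<lambda>e. if f e then link_prob c \<alpha> a n x e else 1 - link_prob c \<alpha> a n x e"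
  have A: "?A = {e \<in> pairs m. local_radius c n < torus_dist n (x (fst e)) (x (snd e))}"
    by (auto simp: pairs_def)
  have fin: "finite ?A" unfolding A by simp
  have eq: "pmf ((\<lambda>(i, j). bernoulli_pmf (min (a * torus_dist n (x i) (x j) powr - \<alpha>) 1)) e) (f e) = ?l e"
    if "e \<in> ?A" for e
    using that by (cases e) (simp add: pmf_bernoulli_clamp link_prob_def)
  have out: "link_prob c \<alpha> a n x e = 0" if "e \<in> pairs m - ?A" for e
    using that by (auto simp: A link_prob_def)
  have "pmf (shortcut_pmf c \<alpha> a n m x) f = (if \<forall>e. e \<notin> ?A \<longrightarrow> \<not> f e then \<Prod>e \<in> ?A. ?l e else 0)"
    unfolding shortcut_pmf_def by (subst pmf_Pi[OF fin]) (simp only: eq cong: prod.cong, simp)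
  also have "\<dots> = (if f \<in> link_sets m then \<Prod>e \<in> pairs m. ?l e else 0)"
  proof (cases "\<forall>e. e \<notin> ?A \<longrightarrow> \<not> f e")
    case True
    then have "f \<in> link_sets m" unfolding A link_sets_def by auto
    moreover have "(\<Prod>e \<in> ?A. ?l e) = (\<Prod>e \<in> pairs m. ?l e)"
    proof (intro prod.mono_neutral_left ballI)
      fix e assume e: "e \<in> pairs m - ?A"
      then have "\<not> f e" using True by blast
      then show "?l e = 1" using out[OF e] by simp
    qed (auto simp: A)
    ultimately show ?thesis using True by simp
  next
    case False
    then obtain e where e: "e \<notin> ?A" "f e" by blast
    have "(\<Prod>e \<in> pairs m. ?l e) = 0" if "f \<in> link_sets m"
    proof -
      have "e \<in> pairs m" using that e by (auto simp: link_sets_def)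
      then show ?thesis using out[of e] e by (intro prod_zero) auto
    qed
    then show ?thesis unfolding if_not_P[OF False] by simp
  qed
  finally show ?thesis .
qed

lemma sum_shortcut_pmf: "(\<Sum>f \<in> link_sets m. pmf (shortcut_pmf c \<alpha> a n m x) f) = 1"
  by (rule sum_pmf_eq_1) (auto simp: set_pmf_eq pmf_shortcut_pmf)

text \<open>The sum in parentheses is the probability of all links other than \<open>e\<close> being as in \<open>f\<close>.\<close>

lemma pmf_shortcut_pmf_link:
  assumes "e \<in> pairs m" "f \<in> link_sets m" "f e"
  shows "pmf (shortcut_pmf c \<alpha> a n m x) f = link_prob c \<alpha> a n x e *
    (pmf (shortcut_pmf c \<alpha> a n m x) f + pmf (shortcut_pmf c \<alpha> a n m x) (f(e := False)))"
proof -
  let ?l = "\<lambda>f e. if f e then link_prob c \<alpha> a n x e else 1 - link_prob c \<alpha> a n x e"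
  have m: "f(e := False) \<in> link_sets m" using assms(2) by (auto simp: link_sets_def)
  have eq: "prod (?l (f(e := False))) (pairs m - {e}) = prod (?l f) (pairs m - {e})"
    by (rule prod.cong) auto
  show ?thesis
    unfolding pmf_shortcut_pmf if_P[OF assms(2)] if_P[OF m] prod.remove[OF finite_pairs assms(1)] eq
    using assms(3) by (simp add: algebra_simps)
qed

text \<open>Independence of one link from the rest: if the weight \<open>g\<close> does not depend on the link \<open>e\<close>, then
  requiring \<open>e\<close> to be present costs the factor \<open>link_prob\<close>. The configurations with \<open>e\<close> are paired
  with those without \<open>e\<close>.\<close>

lemma sum_weighted_link:
  fixes g :: "(nat \<times> nat \<Rightarrow> bool) \<Rightarrow> ennreal" and c \<alpha> a :: real and n :: nat and x :: "nat \<Rightarrow> point"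
  assumes e: "e \<in> pairs m" and inv: "\<And>f. f \<in> link_sets m \<Longrightarrow> f e \<Longrightarrow> g (f(e := False)) = g f"
  defines "q \<equiv> \<lambda>f. ennreal (pmf (shortcut_pmf c \<alpha> a n m x) f)"
  shows "(\<Sum>f \<in> link_sets m. q f * (if f e then g f else 0)) =
    (\<Sum>f \<in> link_sets m. q f * (ennreal (link_prob c \<alpha> a n x e) * g f))"
proof -
  let ?p = "ennreal (link_prob c \<alpha> a n x e)"
  let ?T = "{f \<in> link_sets m. f e}" and ?F = "{f \<in> link_sets m. \<not> f e}"
  have qe: "q f = ?p * (q f + q (f(e := False)))" if "f \<in> ?T" for f
    using that link_prob_bounds(1)[of c \<alpha> a n x e] pmf_shortcut_pmf_link[OF e, of f c \<alpha> a n x] unfolding q_def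
    by (subst ennreal_plus[symmetric], simp, simp, subst ennreal_mult[symmetric]) auto
  have bij: "bij_betw (\<lambda>f. f(e := False)) ?T ?F"
    by (rule bij_betw_byWitness[where f' = "\<lambda>f. f(e := True)"]) (use e in \<open>auto simp: link_sets_def fun_upd_idem_iff split: if_splits\<close>)
  have "(\<Sum>f \<in> link_sets m. q f * (if f e then g f else 0)) = (\<Sum>f \<in> ?T. q f * g f)"
    by (intro sum.mono_neutral_cong_right) auto
  also have "\<dots> = (\<Sum>f \<in> ?T. q f * (?p * g f)) + (\<Sum>f \<in> ?T. q (f(e := False)) * (?p * g (f(e := False))))"
    unfolding sum.distrib[symmetric]
  proof (rule sum.cong)
    fix f assume f: "f \<in> ?T"
    have "q f * g f = ?p * (q f + q (f(e := False))) * g f" using qe[OF f] by simp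
    then show "q f * g f = q f * (?p * g f) + q (f(e := False)) * (?p * g (f(e := False)))"
      using inv[of f] f by (simp add: distrib_left distrib_right mult_ac)
  qed simp
  also have "(\<Sum>f \<in> ?T. q (f(e := False)) * (?p * g (f(e := False)))) = (\<Sum>f \<in> ?F. q f * (?p * g f))"
    by (rule sum.reindex_bij_betw[OF bij])
  also have "(\<Sum>f \<in> ?T. q f * (?p * g f)) + (\<Sum>f \<in> ?F. q f * (?p * g f)) =
      (\<Sum>f \<in> link_sets m. q f * (?p * g f))"
    by (subst sum.union_disjoint[symmetric]) (auto intro!: sum.cong)
  finally show ?thesis .
qed

section \<open>Measurability\<close>

lemma fst_borel [measurable]: "fst \<in> (borel :: point measure) \<rightarrow>\<^sub>M borel"
  and snd_borel [measurable]: "snd \<in> (borel :: point measure) \<rightarrow>\<^sub>M borel"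
  by (intro borel_measurable_continuous_onI continuous_intros)+

lemma torus_dist_measurable [measurable]:
  assumes [measurable]: "f \<in> borel_measurable M" "g \<in> borel_measurable M"
  shows "(\<lambda>w. torus_dist n (f w) (g w)) \<in> borel_measurable M"
  unfolding torus_dist_def circle_dist_def by measurable

lemma link_prob_measurable [measurable]:
  assumes [measurable]: "x \<in> M \<rightarrow>\<^sub>M Pi\<^sub>M UNIV (\<lambda>_. borel)"
  shows "(\<lambda>w. link_prob c \<alpha> a n (x w) e) \<in> borel_measurable M"
proof -
  have [measurable]: "(\<lambda>w. x w i) \<in> borel_measurable M" for i
    by (rule measurable_compose[OF assms measurable_component_singleton]) simp
  show ?thesis unfolding link_prob_def by measurable
qed

lemma pmf_shortcut_pmf_measurable [measurable]:
  assumes [measurable]: "x \<in> M \<rightarrow>\<^sub>M Pi\<^sub>M UNIV (\<lambda>_. borel)"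
  shows "(\<lambda>w. pmf (shortcut_pmf c \<alpha> a n m (x w)) f) \<in> borel_measurable M"
  unfolding pmf_shortcut_pmf by measurable

lemma space_network_space: "space network_space = UNIV"
  by (simp add: network_space_def graph_space_def space_pair_measure space_PiM)

lemma fst_network_measurable: "fst \<in> network_space \<rightarrow>\<^sub>M graph_space"
  by (simp add: network_space_def)

lemma snd_network_measurable: "snd \<in> network_space \<rightarrow>\<^sub>M count_space UNIV"
proof -
  have "snd \<in> network_space \<rightarrow>\<^sub>M (count_space UNIV \<Otimes>\<^sub>M count_space UNIV)"
    by (simp add: network_space_def)
  then show ?thesis by (simp add: pair_measure_countable)
qed

lemma num_nodes_network_measurable: "num_nodes \<in> network_space \<rightarrow>\<^sub>M count_space UNIV"
  unfolding num_nodes_def[abs_def] network_space_def graph_space_def by measurable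

lemma position_network_measurable: "position \<in> network_space \<rightarrow>\<^sub>M Pi\<^sub>M UNIV (\<lambda>_. borel)"
  unfolding position_def[abs_def] network_space_def graph_space_def by measurable

lemma shortcut_network_measurable: "shortcut \<in> network_space \<rightarrow>\<^sub>M Pi\<^sub>M UNIV (\<lambda>_. count_space UNIV)"
  unfolding shortcut_def[abs_def] network_space_def graph_space_def by measurable

lemma graph_measurable:
  "(\<lambda>x. (m, x, f)) \<in> Pi\<^sub>M UNIV (\<lambda>_. borel) \<rightarrow>\<^sub>M graph_space"
  unfolding graph_space_def by (intro measurable_Pair measurable_const measurable_ident) (auto simp: space_PiM)

context small_world
begin

lemma measurable_W: "measurable W N = measurable network_space N"
  by (rule measurable_cong_sets[OF sets_W refl])

lemma space_W: "space W = UNIV"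
  using sets_eq_imp_space_eq[OF sets_W] by (simp add: space_network_space)

lemma W_measurable [measurable]:
  "fst \<in> W \<rightarrow>\<^sub>M graph_space" "snd \<in> W \<rightarrow>\<^sub>M count_space UNIV" "num_nodes \<in> W \<rightarrow>\<^sub>M count_space UNIV"
  "position \<in> W \<rightarrow>\<^sub>M Pi\<^sub>M UNIV (\<lambda>_. borel)" "shortcut \<in> W \<rightarrow>\<^sub>M Pi\<^sub>M UNIV (\<lambda>_. count_space UNIV)"
  unfolding measurable_W
  by (rule fst_network_measurable snd_network_measurable num_nodes_network_measurable
      position_network_measurable shortcut_network_measurable)+

lemma position_measurable [measurable]: "(\<lambda>w. position w i) \<in> borel_measurable W"
  by (rule measurable_compose[OF W_measurable(4) measurable_component_singleton]) simp

lemma shortcut_measurable [measurable]: "(\<lambda>w. shortcut w e) \<in> W \<rightarrow>\<^sub>M count_space UNIV"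
  by (rule measurable_compose[OF W_measurable(5) measurable_component_singleton]) simp

lemma shortcut_eq_measurable [measurable]: "{w \<in> space W. shortcut w = f} \<in> sets W"
  unfolding fun_eq_iff by measurable

lemma destination_measurable [measurable]: "destination \<in> borel_measurable W"
proof -
  have "(\<lambda>w. position w (snd (snd w))) \<in> borel_measurable W"
    by (rule measurable_compose_countable[OF position_measurable]) measurable
  then show ?thesis by (simp add: destination_def[abs_def])
qed

lemma source_measurable [measurable]: "source \<in> borel_measurable W"
proof -
  have "(\<lambda>w. position w (fst (snd w))) \<in> borel_measurable W"
    by (rule measurable_compose_countable[OF position_measurable]) measurable
  then show ?thesis by (simp add: source_def[abs_def])
qed

lemma pred_num_nodes [measurable]: "Measurable.pred W (\<lambda>w. P (num_nodes w))"
  by (rule measurable_compose[OF W_measurable(3)]) simp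

text \<open>Every predicate of the integer components of a network is measurable, as they range over a countable
  set.\<close>

lemma pred_indices: "Measurable.pred W (\<lambda>w. P (num_nodes w) (snd w))"
proof -
  have "(\<lambda>w. (num_nodes w, snd w)) \<in> W \<rightarrow>\<^sub>M count_space UNIV \<Otimes>\<^sub>M count_space UNIV"
    by measurable
  then have "(\<lambda>w. (num_nodes w, snd w)) \<in> W \<rightarrow>\<^sub>M count_space UNIV"
    by (simp add: pair_measure_countable)
  from measurable_compose[OF this, of "\<lambda>(m, st). P m st"] show ?thesis by simp
qed

section \<open>Disintegration\<close>

lemma emeasure_eq_set_nn_integral:
  assumes "S \<in> sets W" "g \<in> borel_measurable W" "\<And>w. 0 \<le> g w" "\<And>w. g w \<le> 1"
    and "measure W A = (LINT w : S | W. g w)"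
  shows "emeasure W A = (\<integral>\<^sup>+w. ennreal (g w) * indicator S w \<partial>W)"
proof -
  have "integrable W (\<lambda>w. indicator S w *\<^sub>R g w)"
    using assms by (intro integrable_const_bound[where B = 1]) (auto split: split_indicator)
  then have "ennreal (LINT w : S | W. g w) = (\<integral>\<^sup>+w. ennreal (indicator S w *\<^sub>R g w) \<partial>W)"
    unfolding set_lebesgue_integral_def using assms(3)
    by (intro nn_integral_eq_integral[symmetric]) (auto split: split_indicator)
  also have "\<dots> = (\<integral>\<^sup>+w. ennreal (g w) * indicator S w \<partial>W)"
    by (intro nn_integral_cong) (auto split: split_indicator)
  finally show ?thesis by (simp add: emeasure_eq_measure assms(5))
qed

definition links_law :: "nat \<Rightarrow> (nat \<Rightarrow> point) \<Rightarrow> (nat \<times> nat \<Rightarrow> bool) \<Rightarrow> ennreal" where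
  "links_law m x f = ennreal (pmf (shortcut_pmf c \<alpha> a n m x) f)"

lemma links_law_measurable [measurable]:
  "x \<in> M \<rightarrow>\<^sub>M Pi\<^sub>M UNIV (\<lambda>_. borel) \<Longrightarrow> (\<lambda>w. links_law m (x w) f) \<in> borel_measurable M"
  unfolding links_law_def by measurable

lemma nn_integral_shortcuts:
  assumes [measurable]: "H \<in> borel_measurable graph_space"
  shows "(\<integral>\<^sup>+w. H (fst w) \<partial>W) =
    (\<integral>\<^sup>+w. (\<Sum>f \<in> link_sets (num_nodes w). links_law (num_nodes w) (position w) f *
        H (num_nodes w, position w, f)) \<partial>W)"
proof -
  have "(\<integral>\<^sup>+w. H (num_nodes w, position w, shortcut w) \<partial>W) =
    (\<integral>\<^sup>+w. (\<Sum>f \<in> link_sets (num_nodes w). links_law (num_nodes w) (position w) f *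
        H (num_nodes w, position w, f)) \<partial>W)"
  proof (rule nn_integral_conditional_law[where Y = num_nodes and X = position and Z = shortcut
        and H = "\<lambda>m f x. H (m, x, f)" and \<kappa> = "\<lambda>m f w. links_law m (position w) f"
        and I = link_sets and N = "Pi\<^sub>M UNIV (\<lambda>_. borel)" and M = W])
    show "finite_measure W" by (rule finite_measure_axioms)
    show "(\<lambda>x. H (m, x, f)) \<in> borel_measurable (Pi\<^sub>M UNIV (\<lambda>_. borel))" for m f
      by (rule measurable_compose[OF graph_measurable assms])
    show "emeasure W {w \<in> space W. num_nodes w = m \<and> position w \<in> A \<and> shortcut w = f} =
        (\<integral>\<^sup>+w. links_law m (position w) f * indicator {w \<in> space W. num_nodes w = m \<and> position w \<in> A} w \<partial>W)"
      if [measurable]: "A \<in> sets (Pi\<^sub>M UNIV (\<lambda>_. borel))" for m f A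
      unfolding links_law_def
    proof (rule emeasure_eq_set_nn_integral)
      show "measure W {w \<in> space W. num_nodes w = m \<and> position w \<in> A \<and> shortcut w = f} =
        (LINT w : {w \<in> space W. num_nodes w = m \<and> position w \<in> A} | W. pmf (shortcut_pmf c \<alpha> a n m (position w)) f)"
        using small_world that unfolding poisson_small_world_def by blast
    qed (auto simp: pmf_le_1)
    show "(\<forall>w. (\<Sum>f \<in> link_sets m. links_law m (position w) f) = 1) \<or> (\<forall>f x. H (m, x, f) = 0)" for m
      by (simp add: links_law_def sum_shortcut_pmf)
    show "(\<lambda>w. H (num_nodes w, position w, shortcut w)) \<in> borel_measurable W"
      by (simp add: num_nodes_def position_def shortcut_def)
  qed measurable
  then show ?thesis by (simp add: num_nodes_def position_def shortcut_def)
qed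

lemma nn_integral_endpoints:
  assumes H [measurable]: "H \<in> borel_measurable network_space"
    and zero: "\<And>w. num_nodes w = 0 \<Longrightarrow> H w = 0"
  shows "(\<integral>\<^sup>+w. H w \<partial>W) =
    (\<integral>\<^sup>+w. (\<Sum>st \<in> {..<num_nodes w} \<times> {..<num_nodes w}. ennreal (1 / (real (num_nodes w))\<^sup>2) * H (fst w, st)) \<partial>W)"
proof -
  have "(\<integral>\<^sup>+w. H (fst w, snd w) * indicator {0<..} (num_nodes w) \<partial>W) =
    (\<integral>\<^sup>+w. (\<Sum>st \<in> {..<num_nodes w} \<times> {..<num_nodes w}. ennreal (1 / (real (num_nodes w))\<^sup>2) *
       (H (fst w, st) * indicator {0<..} (num_nodes w))) \<partial>W)"
  proof (rule nn_integral_conditional_law[where Y = num_nodes and X = fst and Z = snd and N = graph_space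
        and H = "\<lambda>m st g. H (g, st) * indicator {0<..} m" and \<kappa> = "\<lambda>m st w. ennreal (1 / (real m)\<^sup>2)"
        and I = "\<lambda>m. {..<m} \<times> {..<m}" and M = W])
    show "finite_measure W" by (rule finite_measure_axioms)
    show "(\<lambda>g. H (g, st) * indicator {0<..} m) \<in> borel_measurable graph_space" for m :: nat and st
    proof -
      have "(\<lambda>g. (g, st)) \<in> graph_space \<rightarrow>\<^sub>M network_space"
        unfolding network_space_def by (intro measurable_Pair measurable_const measurable_ident) (auto simp: space_pair_measure)
      from measurable_compose[OF this H] show ?thesis by measurable
    qed
    show "emeasure W {w \<in> space W. num_nodes w = m \<and> fst w \<in> A \<and> snd w = st} =
        (\<integral>\<^sup>+w. ennreal (1 / (real m)\<^sup>2) * indicator {w \<in> space W. num_nodes w = m \<and> fst w \<in> A} w \<partial>W)"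
      if st: "st \<in> {..<m} \<times> {..<m}" and [measurable]: "A \<in> sets graph_space" for m st A
    proof -
      obtain i j where ij: "st = (i, j)" "i < m" "j < m" using st by auto
      let ?C = "{g \<in> space graph_space. fst g = m} \<inter> A"
      have C: "?C \<in> sets graph_space"
        using that(2) unfolding graph_space_def by measurable
      have sp: "A \<subseteq> space graph_space" using that(2) by (rule sets.sets_into_space)
      have S: "{w \<in> space W. fst w \<in> ?C \<and> i < num_nodes w \<and> j < num_nodes w} =
          {w \<in> space W. num_nodes w = m \<and> fst w \<in> A}"
        using ij sp by (auto simp: num_nodes_def)
      have S': "{w \<in> space W. fst w \<in> ?C \<and> i < num_nodes w \<and> j < num_nodes w \<and> snd w = (i, j)} =
          {w \<in> space W. num_nodes w = m \<and> fst w \<in> A \<and> snd w = st}"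
        using ij sp by (auto simp: num_nodes_def)
      have "measure W {w \<in> space W. fst w \<in> ?C \<and> i < num_nodes w \<and> j < num_nodes w \<and> snd w = (i, j)} =
          (LINT w : {w \<in> space W. fst w \<in> ?C \<and> i < num_nodes w \<and> j < num_nodes w} | W. 1 / (real (num_nodes w))\<^sup>2)"
        using small_world C unfolding poisson_small_world_def by blast
      then have "emeasure W {w \<in> space W. num_nodes w = m \<and> fst w \<in> A \<and> snd w = st} =
          (\<integral>\<^sup>+w. ennreal (1 / (real (num_nodes w))\<^sup>2) * indicator {w \<in> space W. num_nodes w = m \<and> fst w \<in> A} w \<partial>W)"
        unfolding S S'
        by (rule emeasure_eq_set_nn_integral[rotated 4]) (auto simp: divide_le_eq_1 not_less one_le_power Suc_le_eq)
      also have "\<dots> = (\<integral>\<^sup>+w. ennreal (1 / (real m)\<^sup>2) * indicator {w \<in> space W. num_nodes w = m \<and> fst w \<in> A} w \<partial>W)"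
        by (intro nn_integral_cong) (auto split: split_indicator)
      finally show ?thesis .
    qed
    show "(\<forall>w. (\<Sum>st \<in> {..<m} \<times> {..<m}. ennreal (1 / (real m)\<^sup>2)) = 1) \<or>
        (\<forall>st g. H (g, st) * indicator {0<..} m = 0)" for m :: nat
    proof (cases "m = 0")
      case False
      then have "(\<Sum>st \<in> {..<m} \<times> {..<m}. 1 / (real m)\<^sup>2) = 1"
        by (simp add: power2_eq_square)
      then show ?thesis by (simp add: sum_ennreal del: sum_constant)
    qed simp
    show "(\<lambda>w. H (fst w, snd w) * indicator {0<..} (num_nodes w)) \<in> borel_measurable W"
    proof -
      have "(\<lambda>w. indicator {0<..} (num_nodes w) :: ennreal) \<in> borel_measurable W"
        by (rule measurable_compose[OF W_measurable(3)]) simp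
      then show ?thesis using H unfolding measurable_W[symmetric] by simp
    qed
  qed measurable
  moreover have "(\<integral>\<^sup>+w. H (fst w, snd w) * indicator {0<..} (num_nodes w) \<partial>W) = (\<integral>\<^sup>+w. H w \<partial>W)"
    by (intro nn_integral_cong) (auto simp: zero split: split_indicator)
  moreover have "(\<integral>\<^sup>+w. (\<Sum>st \<in> {..<num_nodes w} \<times> {..<num_nodes w}. ennreal (1 / (real (num_nodes w))\<^sup>2) *
       (H (fst w, st) * indicator {0<..} (num_nodes w))) \<partial>W) =
    (\<integral>\<^sup>+w. (\<Sum>st \<in> {..<num_nodes w} \<times> {..<num_nodes w}. ennreal (1 / (real (num_nodes w))\<^sup>2) * H (fst w, st)) \<partial>W)"
    by (intro nn_integral_cong sum.cong refl) (auto split: split_indicator)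
  ultimately show ?thesis by simp
qed

lemma AE_endpoints: "AE w in W. 0 < num_nodes w \<longrightarrow> fst (snd w) < num_nodes w \<and> snd (snd w) < num_nodes w"
proof -
  let ?B = "{w \<in> space W. 0 < num_nodes w \<and> \<not> (fst (snd w) < num_nodes w \<and> snd (snd w) < num_nodes w)}"
  have B [measurable]: "?B \<in> sets W"
    using pred_indices[of "\<lambda>m st. 0 < m \<and> \<not> (fst st < m \<and> snd st < m)"] by (rule predE)
  have "emeasure W ?B = (\<integral>\<^sup>+w. indicator ?B w \<partial>W)" by (rule nn_integral_indicator[OF B, symmetric])
  also have "\<dots> = (\<integral>\<^sup>+w. (\<Sum>st \<in> {..<num_nodes w} \<times> {..<num_nodes w}.
      ennreal (1 / (real (num_nodes w))\<^sup>2) * indicator ?B (fst w, st)) \<partial>W)"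
  proof (rule nn_integral_endpoints)
    show "indicator ?B \<in> borel_measurable network_space"
      unfolding measurable_W[symmetric] by (rule borel_measurable_indicator[OF B])
  qed auto
  also have "\<dots> = (\<integral>\<^sup>+w. 0 \<partial>W)"
    by (intro nn_integral_cong sum.neutral) (auto simp: num_nodes_def split: split_indicator)
  finally have "emeasure W ?B = 0" by simp
  then have "AE w in W. w \<notin> ?B" by (intro AE_not_in null_setsI[OF _ B])
  then show ?thesis by (auto simp: space_W)
qed

lemma AE_shortcut: "AE w in W. shortcut w \<in> link_sets (num_nodes w)"
proof -
  let ?P = "\<lambda>g :: graph. snd (snd g) \<in> link_sets (fst g)"
  have P [measurable]: "Measurable.pred graph_space ?P"
    unfolding link_sets_def mem_Collect_eq pairs_def graph_space_def split_beta by measurable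
  let ?B = "{w \<in> space W. \<not> ?P (fst w)}"
  have B: "?B \<in> sets W"
    using measurable_compose[OF W_measurable(1) P] by measurable
  have "emeasure W ?B = (\<integral>\<^sup>+w. indicator ?B w \<partial>W)" using B by simp
  also have "\<dots> = (\<integral>\<^sup>+w. indicator {g. \<not> ?P g} (fst w) \<partial>W)"
    by (intro nn_integral_cong) (auto simp: space_W split: split_indicator)
  also have "\<dots> = (\<integral>\<^sup>+w. (\<Sum>f \<in> link_sets (num_nodes w). links_law (num_nodes w) (position w) f *
        indicator {g. \<not> ?P g} (num_nodes w, position w, f)) \<partial>W)"
    by (rule nn_integral_shortcuts) measurable
  also have "\<dots> = (\<integral>\<^sup>+w. 0 \<partial>W)"
    by (intro nn_integral_cong sum.neutral) auto
  finally have "AE w in W. w \<notin> ?B"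
    using B by (intro AE_not_in null_setsI) auto
  then show ?thesis by (auto simp: space_W num_nodes_def shortcut_def)
qed

lemma AE_regular: "AE w in W. 0 < num_nodes w \<longrightarrow> regular n w"
  using AE_nodes AE_endpoints AE_shortcut
  by eventually_elim (auto simp: regular_def link_sets_def pairs_def)

text \<open>Both sides are expanded by integrating out first the endpoints and then the shortcuts. Given the
  positions this leaves a finite sum over the configurations of shortcuts, in which \<open>G\<close> contributes a
  weight that does not depend on the link.\<close>

lemma nn_integral_link:
  assumes [measurable]: "G \<in> sets W" and ij: "i < j" and G: "\<And>w. w \<in> G \<Longrightarrow> j < num_nodes w"
    and inv: "\<And>w b. set_link (i, j) b w \<in> G \<longleftrightarrow> w \<in> G"
  shows "emeasure W {w \<in> G. shortcut w (i, j)} =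
    (\<integral>\<^sup>+w. ennreal (link_prob c \<alpha> a n (position w) (i, j)) * indicator G w \<partial>W)"
proof -
  \<comment> \<open>\<open>ends H\<close> is the conditional expectation of \<open>H\<close> given the graph.\<close>
  define ends where "ends H g = (\<Sum>st \<in> {..<fst g} \<times> {..<fst g}. ennreal (1 / (real (fst g))\<^sup>2) * H (g, st))"
    for H :: "network \<Rightarrow> ennreal" and g :: graph
  have ends_measurable: "ends H \<in> borel_measurable graph_space" if H: "H \<in> borel_measurable network_space" for H
  proof -
    have 1: "(\<lambda>g. H (g, st)) \<in> borel_measurable graph_space" for st
    proof (rule measurable_compose[OF _ H])
      show "(\<lambda>g. (g, st)) \<in> graph_space \<rightarrow>\<^sub>M network_space"
        unfolding network_space_def by (intro measurable_Pair measurable_const measurable_ident) (auto simp: space_pair_measure)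
    qed
    show ?thesis unfolding ends_def
    proof (rule measurable_compose_countable)
      show "fst \<in> graph_space \<rightarrow>\<^sub>M count_space UNIV" unfolding graph_space_def by measurable
    qed (use 1 in measurable)
  qed
  have full: "(\<integral>\<^sup>+w. H w \<partial>W) = (\<integral>\<^sup>+w. (\<Sum>f \<in> link_sets (num_nodes w).
      links_law (num_nodes w) (position w) f * ends H (num_nodes w, position w, f)) \<partial>W)"
    if H: "H \<in> borel_measurable W" and zero: "\<And>w. num_nodes w = 0 \<Longrightarrow> H w = 0" for H
  proof -
    have H': "H \<in> borel_measurable network_space" using H by (simp add: measurable_W)
    have "(\<integral>\<^sup>+w. H w \<partial>W) = (\<integral>\<^sup>+w. ends H (fst w) \<partial>W)"
      unfolding ends_def by (subst nn_integral_endpoints[OF H' zero]) (simp_all add: num_nodes_def)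
    then show ?thesis by (simp only: nn_integral_shortcuts[OF ends_measurable[OF H']])
  qed
  let ?e = "(i, j)"
  let ?p = "\<lambda>w. ennreal (link_prob c \<alpha> a n (position w) ?e)"
  have pos: "0 < num_nodes w" if "w \<in> G" for w using G[OF that] by simp
  have "{w \<in> G. shortcut w ?e} = G \<inter> {w \<in> space W. shortcut w ?e}" by (auto simp: space_W)
  then have "{w \<in> G. shortcut w ?e} \<in> sets W" by simp
  then have "emeasure W {w \<in> G. shortcut w ?e} = (\<integral>\<^sup>+w. indicator {w \<in> G. shortcut w ?e} w \<partial>W)" by simp
  also have "\<dots> = (\<integral>\<^sup>+w. indicator G w * indicator {w. shortcut w ?e} w \<partial>W)"
    by (intro nn_integral_cong) (auto split: split_indicator)
  also have "\<dots> = (\<integral>\<^sup>+w. (\<Sum>f \<in> link_sets (num_nodes w). links_law (num_nodes w) (position w) f *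
      ends (\<lambda>w. indicator G w * indicator {w. shortcut w ?e} w) (num_nodes w, position w, f)) \<partial>W)"
  proof (rule full)
    have "(\<lambda>w. indicator G w * indicator {w \<in> space W. shortcut w ?e} w :: ennreal) \<in> borel_measurable W" by measurable
    then show "(\<lambda>w. indicator G w * indicator {w. shortcut w ?e} w :: ennreal) \<in> borel_measurable W" by (simp add: space_W)
  qed (auto split: split_indicator dest: pos)
  also have "\<dots> = (\<integral>\<^sup>+w. (\<Sum>f \<in> link_sets (num_nodes w). links_law (num_nodes w) (position w) f *
      ends (\<lambda>w. ?p w * indicator G w) (num_nodes w, position w, f)) \<partial>W)"
  proof (intro nn_integral_cong)
    fix w :: network
    let ?m = "num_nodes w" and ?x = "position w"
    let ?g = "\<lambda>f. ends (indicator G) (?m, ?x, f)"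
    have 1: "ends (\<lambda>w. indicator G w * indicator {w. shortcut w ?e} w) (?m, ?x, f) = (if f ?e then ?g f else 0)" for f
      by (auto simp: ends_def shortcut_def)
    have 2: "ends (\<lambda>w. ?p w * indicator G w) (?m, ?x, f) = ennreal (link_prob c \<alpha> a n ?x ?e) * ?g f" for f
    proof -
      have "position ((?m, ?x, f), st) = ?x" for st by (simp add: position_def)
      then show ?thesis unfolding ends_def sum_distrib_left by (intro sum.cong refl) (simp add: mult_ac)
    qed
    show "(\<Sum>f \<in> link_sets ?m. links_law ?m ?x f * ends (\<lambda>w. indicator G w * indicator {w. shortcut w ?e} w) (?m, ?x, f)) =
        (\<Sum>f \<in> link_sets ?m. links_law ?m ?x f * ends (\<lambda>w. ?p w * indicator G w) (?m, ?x, f))"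
    proof (cases "j < ?m")
      case True
      have "?g (f(?e := False)) = ?g f" for f
      proof -
        have "((?m, ?x, f(?e := False)), st) \<in> G \<longleftrightarrow> ((?m, ?x, f), st) \<in> G" for st
          using inv[of False "((?m, ?x, f), st)"]
          by (simp add: set_link_def num_nodes_def position_def shortcut_def)
        then show ?thesis by (simp add: ends_def indicator_def)
      qed
      then show ?thesis unfolding 1 2 links_law_def
        using True ij by (intro sum_weighted_link) (auto simp: pairs_def)
    next
      case False
      then have "?g f = 0" for f
        using G[of "((?m, ?x, f), _)"] by (auto simp: ends_def num_nodes_def indicator_def)
      then show ?thesis unfolding 1 2 by simp
    qed
  qed
  also have "\<dots> = (\<integral>\<^sup>+w. ?p w * indicator G w \<partial>W)"
    by (rule full[symmetric]) (measurable, auto split: split_indicator dest: pos)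
  finally show ?thesis .
qed

end

section \<open>The normalisation\<close>

lemma card_pairs_eq_suminf:
  "ennreal (real (card {e \<in> pairs m. P e})) = (\<Sum>j. \<Sum>i<j. if j < m \<and> P (i, j) then 1 else 0)"
proof -
  have S: "(SIGMA j:{..<m}. {i \<in> {..<j}. P (i, j)}) = prod.swap ` {e \<in> pairs m. P e}"
    by (auto simp: pairs_def image_iff)
  have "card {e \<in> pairs m. P e} = card (SIGMA j:{..<m}. {i \<in> {..<j}. P (i, j)})"
    unfolding S by (subst card_image) auto
  also have "\<dots> = (\<Sum>j<m. card {i \<in> {..<j}. P (i, j)})" by (subst card_SigmaI) auto
  also have "of_nat (\<Sum>j<m. card {i \<in> {..<j}. P (i, j)}) = (\<Sum>j<m. \<Sum>i<j. if P (i, j) then 1 else (0 :: ennreal))"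
    by (simp add: sum.If_cases Int_def)
  finally have "ennreal (real (card {e \<in> pairs m. P e})) = (\<Sum>j<m. \<Sum>i<j. if P (i, j) then 1 else 0)"
    by (simp only: ennreal_of_nat_eq_real_of_nat)
  also have "\<dots> = (\<Sum>j<m. \<Sum>i<j. if j < m \<and> P (i, j) then 1 else 0)"
    by (intro sum.cong) auto
  also have "\<dots> = (\<Sum>j. \<Sum>i<j. if j < m \<and> P (i, j) then 1 else 0)"
    by (rule suminf_finite[symmetric]) auto
  finally show ?thesis .
qed

lemma close_pairs_eq_sum:
  "ennreal (real (close_pairs n r w)) = (\<Sum>st \<in> {..<num_nodes w} \<times> {..<num_nodes w}.
     if torus_dist n (position w (fst st)) (position w (snd st)) < r then 1 else 0)"
proof -
  have "{(i, j). i < num_nodes w \<and> j < num_nodes w \<and> torus_dist n (position w i) (position w j) < r} =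
      {st \<in> {..<num_nodes w} \<times> {..<num_nodes w}. torus_dist n (position w (fst st)) (position w (snd st)) < r}"
    by auto
  then show ?thesis
    by (simp add: close_pairs_def ennreal_of_nat_eq_real_of_nat[symmetric] sum.If_cases Int_def)
qed

text \<open>The degree sum counts each link at both of its ends; the end with the smaller index suffices.\<close>

lemma card_shortcuts_le_degree_sum:
  assumes "inj_on (position w) {..<num_nodes w}"
  shows "card {e \<in> pairs (num_nodes w). shortcut w e} \<le> (\<Sum>u \<in> nodes w. card (shortcut_contacts w u))"
proof -
  let ?P = "{e \<in> pairs (num_nodes w). shortcut w e}"
  let ?S = "Sigma (nodes w) (shortcut_contacts w)"
  have fin: "finite (nodes w)" by (simp add: nodes_def)
  have sub: "shortcut_contacts w u \<subseteq> nodes w" for u unfolding shortcut_contacts_def nodes_def by blast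
  have finS: "finite (shortcut_contacts w u)" for u by (rule finite_subset[OF sub fin])
  have "map_prod (position w) (position w) e \<in> ?S" if "e \<in> ?P" for e
  proof -
    obtain i j where e: "e = (i, j)" "i < num_nodes w" "j < num_nodes w" "shortcut w (i, j)"
      using \<open>e \<in> ?P\<close> by (auto simp: pairs_def)
    then show ?thesis by (auto simp: nodes_def shortcut_contacts_def)
  qed
  then have "map_prod (position w) (position w) ` ?P \<subseteq> ?S" by (rule image_subsetI)
  moreover have "inj_on (map_prod (position w) (position w)) ?P"
    by (rule inj_on_subset[OF map_prod_inj_on[OF assms assms]]) (auto simp: pairs_def)
  moreover have "finite ?S" using fin finS by (rule finite_SigmaI)
  ultimately have "card ?P \<le> card ?S" using card_inj_on_le by blast
  then show ?thesis using fin finS by (simp add: card_SigmaI)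
qed

text \<open>A pair of indices is close, or far in one of the two orders; pairs of equal indices are close.\<close>

lemma num_nodes_square_le:
  assumes "local_radius c n < r" "0 < r"
  shows "(num_nodes w)\<^sup>2 \<le>
    2 * card {e \<in> pairs (num_nodes w). local_radius c n < torus_dist n (position w (fst e)) (position w (snd e))}
      + close_pairs n r w"
proof -
  let ?N = "num_nodes w" and ?x = "position w"
  let ?F = "{e \<in> pairs ?N. local_radius c n < torus_dist n (?x (fst e)) (?x (snd e))}"
  let ?C = "{(i, j). i < ?N \<and> j < ?N \<and> torus_dist n (?x i) (?x j) < r}"
  have finC: "finite ?C" by (rule finite_subset[of _ "{..<?N} \<times> {..<?N}"]) auto
  have finF: "finite ?F" by simp
  have "{..<?N} \<times> {..<?N} \<subseteq> (?F \<union> prod.swap ` ?F) \<union> ?C"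
  proof
    fix p assume "p \<in> {..<?N} \<times> {..<?N}"
    then obtain i j where p: "p = (i, j)" "i < ?N" "j < ?N" by auto
    consider "torus_dist n (?x i) (?x j) < r" | "r \<le> torus_dist n (?x i) (?x j)" "i < j"
      | "r \<le> torus_dist n (?x i) (?x j)" "j < i"
      using assms by (cases i j rule: linorder_cases) force+
    then show "p \<in> (?F \<union> prod.swap ` ?F) \<union> ?C"
    proof cases
      case 3
      then have "(j, i) \<in> ?F" using p assms by (auto simp: pairs_def torus_dist_commute)
      then have "prod.swap (j, i) \<in> prod.swap ` ?F" by (rule imageI)
      then show ?thesis using p by simp
    qed (use p assms in \<open>auto simp: pairs_def\<close>)
  qed
  then have "card ({..<?N} \<times> {..<?N}) \<le> card ((?F \<union> prod.swap ` ?F) \<union> ?C)"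
    using finC finF by (intro card_mono finite_UnI finite_imageI)
  also have "\<dots> \<le> card ?F + card (prod.swap ` ?F) + card ?C"
    by (rule order_trans[OF card_Un_le add_right_mono[OF card_Un_le]])
  also have "card (prod.swap ` ?F) = card ?F" by (intro card_image) auto
  finally show ?thesis by (simp add: close_pairs_def power2_eq_square card_cartesian_product)
qed

lemma link_prob_ge:
  assumes "0 \<le> \<alpha>" "0 \<le> local_radius c n" "x (fst e) \<in> square n" "x (snd e) \<in> square n"
    and far: "local_radius c n < torus_dist n (x (fst e)) (x (snd e))"
  shows "max 0 (min (a * sqrt n powr - \<alpha>) 1) \<le> link_prob c \<alpha> a n x e"
proof (cases "0 \<le> a")
  case True
  have "sqrt n powr - \<alpha> \<le> torus_dist n (x (fst e)) (x (snd e)) powr - \<alpha>"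
    using assms torus_dist_le[OF assms(3,4)] by (intro powr_mono2') auto
  then have "a * sqrt n powr - \<alpha> \<le> a * torus_dist n (x (fst e)) (x (snd e)) powr - \<alpha>"
    using True by (rule mult_left_mono)
  then show ?thesis using far by (auto simp: link_prob_def)
next
  case False
  then have "a * sqrt n powr - \<alpha> \<le> 0" by (intro mult_nonpos_nonneg) auto
  then show ?thesis using link_prob_bounds[of c \<alpha> a n x e] by simp
qed

lemma link_prob_le:
  assumes "0 \<le> \<alpha>" "1 \<le> local_radius c n" "a \<le> p" "0 \<le> p"
  shows "link_prob c \<alpha> a n x e \<le> p"
proof (cases "local_radius c n < torus_dist n (x (fst e)) (x (snd e))")
  case True
  let ?d = "torus_dist n (x (fst e)) (x (snd e))"
  have "?d powr - \<alpha> \<le> 1" using powr_mono[of "- \<alpha>" 0 ?d] True assms by simp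
  then have "a * ?d powr - \<alpha> \<le> p"
    using mult_right_mono[OF assms(3), of "?d powr - \<alpha>"] mult_left_mono[of "?d powr - \<alpha>" 1 p] assms(4) by simp
  then show ?thesis using assms True by (auto simp: link_prob_def)
qed (use assms in \<open>simp add: link_prob_def\<close>)

context small_world
begin

lemma nn_integral_card_pairs:
  assumes [measurable]: "\<And>e. Measurable.pred W (\<lambda>w. P w e)"
  shows "(\<lambda>w. ennreal (real (card {e \<in> pairs (num_nodes w). P w e}))) \<in> borel_measurable W"
    and "(\<integral>\<^sup>+w. ennreal (real (card {e \<in> pairs (num_nodes w). P w e})) \<partial>W) =
      (\<Sum>j. \<Sum>i<j. emeasure W {w \<in> space W. j < num_nodes w \<and> P w (i, j)})"
proof -
  let ?B = "\<lambda>i j. {w \<in> space W. j < num_nodes w \<and> P w (i, j)}"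
  have eq: "ennreal (real (card {e \<in> pairs (num_nodes w). P w e})) = (\<Sum>j. \<Sum>i<j. indicator (?B i j) w)" for w
    unfolding card_pairs_eq_suminf by (intro suminf_cong sum.cong) (auto simp: space_W)
  show "(\<lambda>w. ennreal (real (card {e \<in> pairs (num_nodes w). P w e}))) \<in> borel_measurable W"
    unfolding eq by measurable
  have "(\<integral>\<^sup>+w. (\<Sum>j. \<Sum>i<j. indicator (?B i j) w) \<partial>W) = (\<Sum>j. \<integral>\<^sup>+w. (\<Sum>i<j. indicator (?B i j) w) \<partial>W)"
    by (intro nn_integral_suminf) measurable
  also have "\<dots> = (\<Sum>j. \<Sum>i<j. \<integral>\<^sup>+w. indicator (?B i j) w \<partial>W)"
    by (intro suminf_cong nn_integral_sum) measurable
  also have "\<dots> = (\<Sum>j. \<Sum>i<j. emeasure W (?B i j))"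
    by (intro suminf_cong sum.cong refl nn_integral_indicator) measurable
  finally show "(\<integral>\<^sup>+w. ennreal (real (card {e \<in> pairs (num_nodes w). P w e})) \<partial>W) =
      (\<Sum>j. \<Sum>i<j. emeasure W (?B i j))"
    by (simp only: eq)
qed

lemma close_pairs_measurable: "(\<lambda>w. ennreal (real (close_pairs n r w))) \<in> borel_measurable W"
  unfolding close_pairs_eq_sum by (rule measurable_compose_countable[OF _ W_measurable(3)]) measurable

text \<open>The second moment of the number of nodes is about \<open>n\<^sup>2\<close>, and the close pairs account for at most half
  of it.\<close>

lemma expected_far_pairs_ge:
  assumes r: "1 \<le> r" "2 * r \<le> sqrt n" "local_radius c n < r" "1040 * real n * r\<^sup>2 \<le> (real n)\<^sup>2 / 2"
  shows "ennreal ((real n)\<^sup>2 / 4) \<le> (\<integral>\<^sup>+w. ennreal (real (card {e \<in> pairs (num_nodes w).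
    local_radius c n < torus_dist n (position w (fst e)) (position w (snd e))})) \<partial>W)" (is "_ \<le> ?F")
proof -
  let ?f = "\<lambda>w. real (card {e \<in> pairs (num_nodes w).
    local_radius c n < torus_dist n (position w (fst e)) (position w (snd e))})"
  have f [measurable]: "(\<lambda>w. ennreal (?f w)) \<in> borel_measurable W"
    by (rule nn_integral_card_pairs) measurable
  have "ennreal (n + (real n)\<^sup>2) = (\<integral>\<^sup>+w. ennreal ((real (num_nodes w))\<^sup>2) \<partial>W)"
    by (simp only: num_nodes_moments)
  also have "\<dots> \<le> (\<integral>\<^sup>+w. 2 * ennreal (?f w) + ennreal (real (close_pairs n r w)) \<partial>W)"
  proof (rule nn_integral_mono)
    fix w
    have "real ((num_nodes w)\<^sup>2) \<le> real (2 * card {e \<in> pairs (num_nodes w).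
        local_radius c n < torus_dist n (position w (fst e)) (position w (snd e))} + close_pairs n r w)"
      using r by (intro of_nat_mono num_nodes_square_le) auto
    then have "ennreal ((real (num_nodes w))\<^sup>2) \<le> ennreal (2 * ?f w + real (close_pairs n r w))"
      by (intro ennreal_leI) simp
    then show "ennreal ((real (num_nodes w))\<^sup>2) \<le> 2 * ennreal (?f w) + ennreal (real (close_pairs n r w))"
      by (simp add: ennreal_mult')
  qed
  also have "\<dots> = 2 * ?F + (\<integral>\<^sup>+w. ennreal (real (close_pairs n r w)) \<partial>W)"
    by (subst nn_integral_add[OF _ close_pairs_measurable]) (measurable, simp only: nn_integral_cmult[OF f])
  also have "\<dots> \<le> 2 * ?F + ennreal ((real n)\<^sup>2 / 2)"
    using expected_close_pairs[OF r(1,2)] r(4) by (intro add_left_mono) (meson ennreal_leI order_trans)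
  finally have *: "ennreal (n + (real n)\<^sup>2) \<le> 2 * ?F + ennreal ((real n)\<^sup>2 / 2)" .
  show ?thesis
  proof (cases ?F)
    case (real F)
    have "ennreal (n + (real n)\<^sup>2) \<le> ennreal (2 * F + (real n)\<^sup>2 / 2)"
      using * real by (simp add: ennreal_mult')
    then have "n + (real n)\<^sup>2 \<le> 2 * F + (real n)\<^sup>2 / 2"
      using real by (subst (asm) ennreal_le_iff) auto
    then show ?thesis using real by (simp add: ennreal_leI)
  qed simp
qed

text \<open>The expected number of links is at least the expected number of far pairs times the connection
  probability at distance \<open>sqrt n\<close>, which no distance on the torus exceeds.\<close>

lemma mean_shortcuts_ge:
  assumes \<alpha>: "0 \<le> \<alpha>" and rad: "0 \<le> local_radius c n" and n: "0 < n"
    and r: "1 \<le> r" "2 * r \<le> sqrt n" "local_radius c n < r" "1040 * real n * r\<^sup>2 \<le> (real n)\<^sup>2 / 2"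
    and mean: "mean_shortcuts W = d" and d: "0 < d"
  shows "min (a * sqrt n powr - \<alpha>) 1 \<le> 4 * d / n"
proof -
  let ?S = "\<lambda>w. \<Sum>u \<in> nodes w. real (card (shortcut_contacts w u))"
  let ?far = "\<lambda>w e. local_radius c n < torus_dist n (position w (fst e)) (position w (snd e))"
  define q where "q = max 0 (min (a * sqrt n powr - \<alpha>) 1)"
  have q: "0 \<le> q" by (simp add: q_def)
  \<comment> \<open>A nonintegrable function has integral 0, which would make the quotient 0.\<close>
  have int: "integrable W ?S" "integrable W (\<lambda>w. real (card (nodes w)))"
    using mean d unfolding mean_shortcuts_def by (auto intro: ccontr simp: not_integrable_integral_eq)
  have "ennreal (\<integral>w. real (card (nodes w)) \<partial>W) = (\<integral>\<^sup>+w. ennreal (real (card (nodes w))) \<partial>W)"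
    using int by (intro nn_integral_eq_integral[symmetric]) auto
  also have "\<dots> = (\<integral>\<^sup>+w. ennreal (real (num_nodes w)) \<partial>W)"
    using AE_nodes by (intro nn_integral_cong_AE) (auto simp: nodes_def card_image elim: eventually_mono)
  finally have "(\<integral>w. real (card (nodes w)) \<partial>W) = n"
    unfolding num_nodes_moments by (subst (asm) ennreal_inj) auto
  then have S: "(\<integral>w. ?S w \<partial>W) = d * n" using mean n by (simp add: mean_shortcuts_def field_simps)
  have "ennreal q * ennreal ((real n)\<^sup>2 / 4) \<le>
      ennreal q * (\<integral>\<^sup>+w. ennreal (real (card {e \<in> pairs (num_nodes w). ?far w e})) \<partial>W)"
    by (intro mult_left_mono expected_far_pairs_ge[OF r]) auto
  also have "\<dots> = ennreal q * (\<Sum>j. \<Sum>i<j. emeasure W {w \<in> space W. j < num_nodes w \<and> ?far w (i, j)})"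
    by (subst nn_integral_card_pairs) measurable
  also have "\<dots> = (\<Sum>j. \<Sum>i<j. ennreal q * emeasure W {w \<in> space W. j < num_nodes w \<and> ?far w (i, j)})"
    by (simp only: sum_distrib_left[symmetric] ennreal_suminf_cmult)
  also have "\<dots> \<le> (\<Sum>j. \<Sum>i<j. emeasure W {w \<in> space W. j < num_nodes w \<and> shortcut w (i, j)})"
  proof (intro suminf_le sum_mono summableI)
    fix i j :: nat assume "i \<in> {..<j}"
    then have ij: "i < j" by simp
    let ?G = "{w \<in> space W. j < num_nodes w \<and> ?far w (i, j)}"
    have G [measurable]: "?G \<in> sets W" by measurable
    have "ennreal q * emeasure W ?G = (\<integral>\<^sup>+w. ennreal q * indicator ?G w \<partial>W)"
      by (simp add: nn_integral_cmult_indicator)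
    also have "\<dots> \<le> (\<integral>\<^sup>+w. ennreal (link_prob c \<alpha> a n (position w) (i, j)) * indicator ?G w \<partial>W)"
    proof (rule nn_integral_mono_AE, use AE_nodes in eventually_elim)
      case (elim w)
      show ?case
      proof (cases "w \<in> ?G")
        case True
        then have "position w i \<in> square n" "position w j \<in> square n"
          using elim ij by (auto simp: nodes_def)
        then have "q \<le> link_prob c \<alpha> a n (position w) (i, j)"
          unfolding q_def using True \<alpha> rad by (intro link_prob_ge) auto
        then show ?thesis using True by (simp add: ennreal_leI)
      qed simp
    qed
    also have "\<dots> = emeasure W {w \<in> ?G. shortcut w (i, j)}"
      by (rule nn_integral_link[OF G ij, symmetric]) (auto simp: space_W)
    also have "\<dots> \<le> emeasure W {w \<in> space W. j < num_nodes w \<and> shortcut w (i, j)}"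
      by (intro emeasure_mono) (auto, measurable)
    finally show "ennreal q * emeasure W ?G \<le> emeasure W {w \<in> space W. j < num_nodes w \<and> shortcut w (i, j)}" .
  qed
  also have "\<dots> = (\<integral>\<^sup>+w. ennreal (real (card {e \<in> pairs (num_nodes w). shortcut w e})) \<partial>W)"
    by (rule nn_integral_card_pairs(2)[symmetric]) measurable
  also have "\<dots> \<le> (\<integral>\<^sup>+w. ennreal (?S w) \<partial>W)"
  proof (rule nn_integral_mono_AE, use AE_nodes in eventually_elim)
    case (elim w)
    then have "real (card {e \<in> pairs (num_nodes w). shortcut w e}) \<le> real (\<Sum>u \<in> nodes w. card (shortcut_contacts w u))"
      by (intro of_nat_mono card_shortcuts_le_degree_sum) auto
    then show ?case by (intro ennreal_leI) simp
  qed
  also have "\<dots> = ennreal (d * n)"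
    unfolding S[symmetric] using int by (intro nn_integral_eq_integral) (auto simp: sum_nonneg)
  finally have "q * ((real n)\<^sup>2 / 4) \<le> d * n"
    using q d n by (simp add: ennreal_mult[symmetric] ennreal_le_iff)
  then have "q \<le> 4 * d / n" using n by (simp add: field_simps power2_eq_square)
  then show ?thesis by (simp add: q_def)
qed

section \<open>Nodes near the destination and fresh links\<close>

text \<open>Given the graph, the destination is each of the \<open>num_nodes w\<close> nodes with equal probability, so the
  mean number of nodes near it is the number of close pairs divided by the number of nodes.\<close>

lemma nn_integral_near_destination:
  assumes "0 < n"
  shows "(\<integral>\<^sup>+w. (if n \<le> 2 * num_nodes w
        then ennreal (real (card {v. v < num_nodes w \<and> torus_dist n (position w v) (destination w) < r})) else 0) \<partial>W)
    \<le> ennreal (2 / n) * (\<integral>\<^sup>+w. ennreal (real (close_pairs n r w)) \<partial>W)"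
proof -
  let ?near = "\<lambda>w y. \<Sum>v<num_nodes w. if torus_dist n (position w v) y < r then 1 else (0 :: ennreal)"
  let ?H = "\<lambda>w. if n \<le> 2 * num_nodes w then ?near w (destination w) else 0"
  have card: "ennreal (real (card {v. v < num_nodes w \<and> torus_dist n (position w v) (destination w) < r})) =
      ?near w (destination w)" for w
    by (simp add: ennreal_of_nat_eq_real_of_nat[symmetric] sum.If_cases Int_def)
  have near: "(\<lambda>w. ?near w (destination w)) \<in> borel_measurable W"
    by (rule measurable_compose_countable[OF _ W_measurable(3)]) measurable
  have "?H \<in> borel_measurable W"
    by (rule measurable_If[OF near]) measurable
  then have "(\<integral>\<^sup>+w. ?H w \<partial>W) = (\<integral>\<^sup>+w. (\<Sum>st \<in> {..<num_nodes w} \<times> {..<num_nodes w}.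
      ennreal (1 / (real (num_nodes w))\<^sup>2) * ?H (fst w, st)) \<partial>W)"
    by (intro nn_integral_endpoints) (auto simp: measurable_W)
  also have "\<dots> \<le> (\<integral>\<^sup>+w. ennreal (2 / n) * ennreal (real (close_pairs n r w)) \<partial>W)"
  proof (rule nn_integral_mono)
    fix w
    let ?N = "num_nodes w" and ?I = "{..<num_nodes w}"
    have H: "?H (fst w, st) = (if n \<le> 2 * ?N then ?near w (position w (snd st)) else 0)" for st
      by (simp add: num_nodes_def position_def destination_def)
    have near_sum: "(\<Sum>st \<in> ?I \<times> ?I. ?near w (position w (snd st))) = of_nat ?N * ennreal (real (close_pairs n r w))"
    proof -
      have prod: "(\<Sum>st \<in> ?I \<times> ?I. g (fst st) (snd st)) = (\<Sum>s \<in> ?I. \<Sum>t \<in> ?I. g s t)"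
        for g :: "nat \<Rightarrow> nat \<Rightarrow> ennreal"
        by (simp add: sum.cartesian_product split_beta)
      have "(\<Sum>st \<in> ?I \<times> ?I. ?near w (position w (snd st))) = of_nat ?N * (\<Sum>t \<in> ?I. ?near w (position w t))"
        by (subst prod) simp
      also have "(\<Sum>t \<in> ?I. ?near w (position w t)) =
          (\<Sum>v \<in> ?I. \<Sum>t \<in> ?I. if torus_dist n (position w v) (position w t) < r then 1 else 0)"
        by (rule sum.swap)
      also have "\<dots> = ennreal (real (close_pairs n r w))"
        unfolding close_pairs_eq_sum by (rule prod[symmetric])
      finally show ?thesis .
    qed
    show "(\<Sum>st \<in> ?I \<times> ?I. ennreal (1 / (real ?N)\<^sup>2) * ?H (fst w, st)) \<le>
        ennreal (2 / n) * ennreal (real (close_pairs n r w))"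
    proof (cases "n \<le> 2 * ?N")
      case True
      then have N: "0 < ?N" using \<open>0 < n\<close> by simp
      have "real n \<le> 2 * real ?N" using True by linarith
      then have le: "1 / real ?N \<le> 2 / real n" using N \<open>0 < n\<close> by (simp add: field_simps)
      have "(\<Sum>st \<in> ?I \<times> ?I. ennreal (1 / (real ?N)\<^sup>2) * ?H (fst w, st)) =
          ennreal (1 / (real ?N)\<^sup>2) * (of_nat ?N * ennreal (real (close_pairs n r w)))"
        unfolding H if_P[OF True] sum_distrib_left[symmetric] near_sum ..
      also have "\<dots> = ennreal (1 / real ?N) * ennreal (real (close_pairs n r w))"
        using N by (simp add: ennreal_of_nat_eq_real_of_nat ennreal_mult[symmetric] power2_eq_square)
      also have "\<dots> \<le> ennreal (2 / n) * ennreal (real (close_pairs n r w))"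
        using le by (intro mult_right_mono ennreal_leI) auto
      finally show ?thesis .
    next
      case False
      then show ?thesis unfolding H by simp
    qed
  qed
  also have "\<dots> = ennreal (2 / n) * (\<integral>\<^sup>+w. ennreal (real (close_pairs n r w)) \<partial>W)"
    by (rule nn_integral_cmult[OF close_pairs_measurable])
  finally show ?thesis unfolding card .
qed

lemma source_near_destination:
  assumes "0 < n"
  shows "emeasure W {w \<in> space W. n \<le> 2 * num_nodes w \<and> torus_dist n (source w) (destination w) < r}
    \<le> ennreal (4 / (real n)\<^sup>2) * (\<integral>\<^sup>+w. ennreal (real (close_pairs n r w)) \<partial>W)"
proof -
  let ?B = "{w \<in> space W. n \<le> 2 * num_nodes w \<and> torus_dist n (source w) (destination w) < r}"
  have B: "?B \<in> sets W" by measurable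
  have "emeasure W ?B = (\<integral>\<^sup>+w. indicator ?B w \<partial>W)" by (rule nn_integral_indicator[OF B, symmetric])
  also have "\<dots> = (\<integral>\<^sup>+w. (\<Sum>st \<in> {..<num_nodes w} \<times> {..<num_nodes w}.
      ennreal (1 / (real (num_nodes w))\<^sup>2) * indicator ?B (fst w, st)) \<partial>W)"
  proof (rule nn_integral_endpoints)
    show "indicator ?B \<in> borel_measurable network_space"
      unfolding measurable_W[symmetric] by (rule borel_measurable_indicator[OF B])
  qed (use assms in auto)
  also have "\<dots> \<le> (\<integral>\<^sup>+w. ennreal (4 / (real n)\<^sup>2) * ennreal (real (close_pairs n r w)) \<partial>W)"
  proof (rule nn_integral_mono)
    fix w
    let ?N = "num_nodes w" and ?I = "{..<num_nodes w}"
    show "(\<Sum>st \<in> ?I \<times> ?I. ennreal (1 / (real ?N)\<^sup>2) * indicator ?B (fst w, st)) \<le>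
        ennreal (4 / (real n)\<^sup>2) * ennreal (real (close_pairs n r w))"
    proof (cases "n \<le> 2 * ?N")
      case True
      then have N: "0 < ?N" using \<open>0 < n\<close> by simp
      have "real n \<le> 2 * real ?N" using True by linarith
      then have "(real n)\<^sup>2 \<le> (2 * real ?N)\<^sup>2" by (intro power_mono) auto
      then have le: "1 / (real ?N)\<^sup>2 \<le> 4 / (real n)\<^sup>2" using N \<open>0 < n\<close> by (simp add: field_simps)
      have ind: "indicator ?B (fst w, st) =
          (if torus_dist n (position w (fst st)) (position w (snd st)) < r then 1 else (0 :: ennreal))" for st
        using True by (simp add: space_W num_nodes_def position_def source_def destination_def indicator_def)
      have "(\<Sum>st \<in> ?I \<times> ?I. ennreal (1 / (real ?N)\<^sup>2) * indicator ?B (fst w, st)) =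
          ennreal (1 / (real ?N)\<^sup>2) * ennreal (real (close_pairs n r w))"
        unfolding ind sum_distrib_left[symmetric] close_pairs_eq_sum ..
      also have "\<dots> \<le> ennreal (4 / (real n)\<^sup>2) * ennreal (real (close_pairs n r w))"
        using le by (intro mult_right_mono ennreal_leI) auto
      finally show ?thesis .
    next
      case False
      then have "indicator ?B (fst w, st) = (0 :: ennreal)" for st
        by (simp add: num_nodes_def indicator_def)
      then show ?thesis by simp
    qed
  qed
  also have "\<dots> = ennreal (4 / (real n)\<^sup>2) * (\<integral>\<^sup>+w. ennreal (real (close_pairs n r w)) \<partial>W)"
    by (rule nn_integral_cmult[OF close_pairs_measurable])
  finally show ?thesis .
qed

text \<open>Chebyshev's inequality: the number of nodes has mean and variance \<open>n\<close>.\<close>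

lemma few_nodes:
  assumes "0 < n"
  shows "emeasure W {w \<in> space W. \<not> n \<le> 2 * num_nodes w} \<le> ennreal (4 / n)"
proof -
  let ?X = "\<lambda>w. real (num_nodes w)"
  have X [measurable]: "?X \<in> borel_measurable W"
    by (rule measurable_compose[OF W_measurable(3)]) simp
  have int: "integrable W ?X" "integrable W (\<lambda>w. (?X w)\<^sup>2)"
    using num_nodes_moments by (auto intro!: integrableI_nonneg)
  have E: "expectation ?X = n"
    by (subst integral_eq_nn_integral) (simp_all add: num_nodes_moments)
  have "expectation (\<lambda>w. (?X w)\<^sup>2) = enn2real (ennreal (n + (real n)\<^sup>2))"
    unfolding num_nodes_moments(2)[symmetric] by (rule integral_eq_nn_integral) auto
  then have E2: "expectation (\<lambda>w. (?X w)\<^sup>2) = n + (real n)\<^sup>2"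
    by (simp only: enn2real_ennreal add_nonneg_nonneg of_nat_0_le_iff zero_le_power2)
  have "variance ?X = expectation (\<lambda>w. (?X w)\<^sup>2) - (expectation ?X)\<^sup>2" by (rule variance_eq[OF int])
  also have "\<dots> = n" unfolding E E2 by simp
  finally have var: "variance ?X = n" .
  have "prob {w \<in> space W. n / 2 \<le> \<bar>?X w - expectation ?X\<bar>} \<le> variance ?X / (n / 2)\<^sup>2"
    using int assms by (intro Chebyshev_inequality X) auto
  also have "\<dots> = n / (n / 2)\<^sup>2" unfolding var ..
  also have "\<dots> = 4 / n" using assms by (simp add: power2_eq_square field_simps)
  finally have *: "emeasure W {w \<in> space W. n / 2 \<le> \<bar>?X w - n\<bar>} \<le> ennreal (4 / n)"
    unfolding E by (simp add: emeasure_eq_measure ennreal_leI)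
  have "emeasure W {w \<in> space W. \<not> n \<le> 2 * num_nodes w} \<le> emeasure W {w \<in> space W. n / 2 \<le> \<bar>?X w - n\<bar>}"
  proof (rule emeasure_mono)
    show "{w \<in> space W. n / 2 \<le> \<bar>?X w - n\<bar>} \<in> sets W" by measurable
  qed auto
  then show ?thesis using * by (rule order_trans)
qed

text \<open>The seed of the algorithm is fixed first; the network is independent of it.\<close>

lemma fresh_link_bound:
  assumes R: "prob_space R" and E: "E \<in> sets (W \<Otimes>\<^sub>M R)" and ij: "i < j"
    and nodes: "\<And>w \<rho>. (w, \<rho>) \<in> E \<Longrightarrow> j < num_nodes w"
    and inv: "\<And>w \<rho> b. (set_link (i, j) b w, \<rho>) \<in> E \<longleftrightarrow> (w, \<rho>) \<in> E"
    and p: "\<And>w. link_prob c \<alpha> a n (position w) (i, j) \<le> p"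
  shows "{x \<in> E. shortcut (fst x) (i, j)} \<in> sets (W \<Otimes>\<^sub>M R)"
    and "emeasure (W \<Otimes>\<^sub>M R) {x \<in> E. shortcut (fst x) (i, j)} \<le> ennreal p * emeasure (W \<Otimes>\<^sub>M R) E"
proof -
  interpret R: prob_space R by fact
  interpret pair_sigma_finite W R ..
  have sub: "E \<subseteq> space (W \<Otimes>\<^sub>M R)" using E by (rule sets.sets_into_space)
  have "{x \<in> E. shortcut (fst x) (i, j)} = E \<inter> {x \<in> space (W \<Otimes>\<^sub>M R). shortcut (fst x) (i, j)}"
    using sub by auto
  then show meas: "{x \<in> E. shortcut (fst x) (i, j)} \<in> sets (W \<Otimes>\<^sub>M R)" using E by simp
  have "emeasure (W \<Otimes>\<^sub>M R) {x \<in> E. shortcut (fst x) (i, j)} =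
      (\<integral>\<^sup>+\<rho>. emeasure W ((\<lambda>w. (w, \<rho>)) -` {x \<in> E. shortcut (fst x) (i, j)}) \<partial>R)"
    by (rule emeasure_pair_measure_alt2[OF meas])
  also have "\<dots> \<le> (\<integral>\<^sup>+\<rho>. ennreal p * emeasure W ((\<lambda>w. (w, \<rho>)) -` E) \<partial>R)"
  proof (rule nn_integral_mono)
    fix \<rho>
    let ?G = "(\<lambda>w. (w, \<rho>)) -` E"
    have G: "?G \<in> sets W" using E by (rule sets_Pair2)
    have "emeasure W ((\<lambda>w. (w, \<rho>)) -` {x \<in> E. shortcut (fst x) (i, j)}) = emeasure W {w \<in> ?G. shortcut w (i, j)}"
      by (rule arg_cong[where f = "emeasure W"]) auto
    also have "\<dots> = (\<integral>\<^sup>+w. ennreal (link_prob c \<alpha> a n (position w) (i, j)) * indicator ?G w \<partial>W)"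
      by (rule nn_integral_link[OF G ij]) (auto simp: nodes inv)
    also have "\<dots> \<le> (\<integral>\<^sup>+w. ennreal p * indicator ?G w \<partial>W)"
      using p by (intro nn_integral_mono mult_right_mono ennreal_leI) auto
    also have "\<dots> = ennreal p * emeasure W ?G" using G by (rule nn_integral_cmult_indicator)
    finally show "emeasure W ((\<lambda>w. (w, \<rho>)) -` {x \<in> E. shortcut (fst x) (i, j)}) \<le> ennreal p * emeasure W ?G" .
  qed
  also have "\<dots> = ennreal p * emeasure (W \<Otimes>\<^sub>M R) E"
    unfolding emeasure_pair_measure_alt2[OF E]
    using E by (intro nn_integral_cmult measurable_emeasure_Pair2)
  finally show "emeasure (W \<Otimes>\<^sub>M R) {x \<in> E. shortcut (fst x) (i, j)} \<le> ennreal p * emeasure (W \<Otimes>\<^sub>M R) E" .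
qed

end

section \<open>Early arrival is improbable\<close>

lemma hops_greater_iff:
  "ereal y < ereal_of_enat (hops \<A> c n w \<rho>) \<longleftrightarrow>
     (\<forall>k. real k \<le> y \<longrightarrow> visited \<A> c n w \<rho> k \<noteq> destination w)"
proof (cases "\<exists>k. visited \<A> c n w \<rho> k = destination w")
  case True
  let ?L = "LEAST k. visited \<A> c n w \<rho> k = destination w"
  have h: "hops \<A> c n w \<rho> = enat ?L" using True by (simp add: hops_def)
  have L: "visited \<A> c n w \<rho> ?L = destination w" using True by (rule LeastI_ex)
  show ?thesis
  proof
    assume "ereal y < ereal_of_enat (hops \<A> c n w \<rho>)"
    then have y: "y < real ?L" unfolding h by simp
    show "\<forall>k. real k \<le> y \<longrightarrow> visited \<A> c n w \<rho> k \<noteq> destination w"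
    proof (intro allI impI)
      fix k assume "real k \<le> y"
      with y have "k < ?L" by linarith
      then show "visited \<A> c n w \<rho> k \<noteq> destination w" by (rule not_less_Least)
    qed
  next
    assume "\<forall>k. real k \<le> y \<longrightarrow> visited \<A> c n w \<rho> k \<noteq> destination w"
    with L have "\<not> real ?L \<le> y" by blast
    then show "ereal y < ereal_of_enat (hops \<A> c n w \<rho>)" unfolding h by simp
  qed
next
  case False
  then show ?thesis by (simp add: hops_def)
qed

text \<open>The node visited at time \<open>k\<close> has only one index \<open>u\<close>.\<close>

lemma suminf_exposes_le:
  fixes r :: real
  shows "(\<Sum>u. \<Sum>v. if exposes \<A> c n r w \<rho> k u v then 1 else (0 :: ennreal)) \<le>
    ennreal (real (card {v. v < num_nodes w \<and> torus_dist n (position w v) (destination w) < r}))"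
proof (cases "\<exists>u v. exposes \<A> c n r w \<rho> k u v")
  case True
  let ?e = "exposes \<A> c n r w \<rho> k"
  let ?V = "{v. v < num_nodes w \<and> torus_dist n (position w v) (destination w) < r}"
  from True obtain u0 v0 where e0: "?e u0 v0" by blast
  have u0: "u = u0" if e: "?e u v" for u v
  proof (rule inj_onD)
    show "inj_on (position w) {..<num_nodes w}" "u \<in> {..<num_nodes w}" "u0 \<in> {..<num_nodes w}"
      using e e0 by (simp_all add: exposes_def)
    have "visited \<A> c n w \<rho> k = position w u" "visited \<A> c n w \<rho> k = position w u0"
      using e e0 by (simp_all only: exposes_def)
    then show "position w u = position w u0" by (rule trans[OF sym])
  qed
  have V: "v \<in> ?V" if "?e u v" for u v using that by (simp add: exposes_def)
  have fin: "finite ?V" by simp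
  have "(\<Sum>u. \<Sum>v. if ?e u v then 1 else (0 :: ennreal)) = (\<Sum>v. if ?e u0 v then 1 else 0)"
  proof (subst suminf_finite[of "{u0}"])
    show "(\<Sum>v. if ?e u v then 1 else (0 :: ennreal)) = 0" if "u \<notin> {u0}" for u
    proof -
      have "\<not> ?e u v" for v using u0[of u v] that by blast
      then show ?thesis by simp
    qed
  qed simp_all
  also have "\<dots> = (\<Sum>v \<in> ?V. if ?e u0 v then 1 else 0)"
  proof (rule suminf_finite[OF fin])
    show "(if ?e u0 v then 1 else (0 :: ennreal)) = 0" if "v \<notin> ?V" for v
      using V[of u0 v] that by (intro if_not_P) blast
  qed
  also have "\<dots> \<le> (\<Sum>v \<in> ?V. 1)" by (intro sum_mono) auto
  finally show ?thesis by (simp add: ennreal_of_nat_eq_real_of_nat)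
next
  case False
  then show ?thesis by simp
qed

context small_world
begin

lemma near_destination_measurable:
  "(\<lambda>w. ennreal (real (card {v. v < num_nodes w \<and> torus_dist n (position w v) (destination w) < r})))
     \<in> borel_measurable W"
proof -
  have eq: "ennreal (real (card {v. v < num_nodes w \<and> torus_dist n (position w v) (destination w) < r})) =
      (\<Sum>v<num_nodes w. if torus_dist n (position w v) (destination w) < r then 1 else (0 :: ennreal))" for w
    by (simp add: ennreal_of_nat_eq_real_of_nat[symmetric] sum.If_cases Int_def)
  show ?thesis
    unfolding eq by (rule measurable_compose_countable[OF _ W_measurable(3)]) measurable
qed

text \<open>An early arrival requires that the network has few nodes, or that the source is near the destination,
  or that for some time \<open>k < K\<close> an exposed link is present. For each time the expected number of exposed
  links is at most the expected number of nodes near the destination, and each is present with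
  probability at most \<open>p\<close>.\<close>

lemma early_arrival_bound:
  assumes RA: "routing_algorithm c n W R \<A>" and n: "0 < n" and \<alpha>: "0 \<le> \<alpha>"
    and rad: "1 \<le> local_radius c n" and p: "a \<le> p" "0 \<le> p"
    and r: "1 \<le> r" "2 * r \<le> sqrt n" and K: "real K * local_radius c n < r"
  shows "emeasure (W \<Otimes>\<^sub>M R)
      {x \<in> space (W \<Otimes>\<^sub>M R). \<exists>k \<le> K. visited \<A> c n (fst x) (snd x) k = destination (fst x)}
    \<le> ennreal (4 / n + 4160 * r\<^sup>2 / n + 2080 * real K * p * r\<^sup>2)"
proof -
  let ?P = "W \<Otimes>\<^sub>M R"
  have R: "prob_space R" and dec: "decentralised \<A>" using RA by (auto simp: routing_algorithm_def)
  interpret R: prob_space R by (rule R)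
  interpret pair_prob_space W R ..
  have fst_P: "distr ?P W fst = W" by (rule R.distr_pair_fst)
  have visited [measurable]: "(\<lambda>x. visited \<A> c n (fst x) (snd x) k) \<in> borel_measurable ?P" for k
    using RA unfolding routing_algorithm_def case_prod_beta' by blast
  have pred [measurable]: "Measurable.pred ?P (\<lambda>x. Q (num_nodes (fst x)))" for Q
    by (rule measurable_compose[OF measurable_fst pred_num_nodes])
  have near_int: "(\<integral>\<^sup>+w. ennreal (real (close_pairs n r w)) \<partial>W) \<le> ennreal (1040 * real n * r\<^sup>2)"
    by (rule expected_close_pairs[OF r])
  let ?E = "\<lambda>k u v. {x \<in> space ?P. n \<le> 2 * num_nodes (fst x) \<and> exposes \<A> c n r (fst x) (snd x) k u v}"
  let ?B = "\<lambda>k u v. {x \<in> ?E k u v. shortcut (fst x) (link u v)}"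
  have E [measurable]: "?E k u v \<in> sets ?P" for k u v
    unfolding exposes_def inj_on_def lessThan_iff Ball_def by measurable
  have B: "?B k u v \<in> sets ?P \<and> emeasure ?P (?B k u v) \<le> ennreal p * emeasure ?P (?E k u v)" for k u v
  proof (cases "u = v")
    case True
    then show ?thesis by (simp add: exposes_def)
  next
    case False
    then have "min u v < max u v" by simp
    moreover have "max u v < num_nodes w" if "(w, \<rho>) \<in> ?E k u v" for w \<rho>
      using that by (simp add: exposes_def)
    moreover have "(set_link (min u v, max u v) b w, \<rho>) \<in> ?E k u v \<longleftrightarrow> (w, \<rho>) \<in> ?E k u v" for w \<rho> b
      using exposes_set_link[of \<A> c n r u v b w \<rho> k]
      by (simp add: link_def space_pair_measure space_W)
    moreover have "link_prob c \<alpha> a n (position w) (min u v, max u v) \<le> p" for w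
      by (rule link_prob_le[OF \<alpha> rad p])
    ultimately show ?thesis
      using fresh_link_bound[OF R E, of "min u v" "max u v" k u v p] unfolding link_def by blast
  qed
  let ?Bad = "\<Union>k \<in> {..<K}. \<Union>u. \<Union>v. ?B k u v"
  have Bad: "?Bad \<in> sets ?P" using B by (intro sets.finite_UN sets.countable_UN) auto
  have "emeasure ?P (\<Union>u. \<Union>v. ?B k u v) \<le> ennreal (2080 * p * r\<^sup>2)" for k
  proof -
    have "emeasure ?P (\<Union>u. \<Union>v. ?B k u v) \<le> (\<Sum>u. emeasure ?P (\<Union>v. ?B k u v))"
      using B by (intro emeasure_subadditive_countably) (auto intro!: sets.countable_UN)
    also have "\<dots> \<le> (\<Sum>u. \<Sum>v. emeasure ?P (?B k u v))"
      using B by (intro suminf_le summableI emeasure_subadditive_countably) auto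
    also have "\<dots> \<le> (\<Sum>u. \<Sum>v. ennreal p * emeasure ?P (?E k u v))"
      using B by (intro suminf_le summableI) auto
    also have "\<dots> = ennreal p * (\<Sum>u. \<Sum>v. emeasure ?P (?E k u v))"
      by (simp only: ennreal_suminf_cmult)
    also have "(\<Sum>u. \<Sum>v. emeasure ?P (?E k u v)) = (\<integral>\<^sup>+x. (\<Sum>u. \<Sum>v. indicator (?E k u v) x) \<partial>?P)"
    proof -
      have "(\<integral>\<^sup>+x. (\<Sum>u. \<Sum>v. indicator (?E k u v) x) \<partial>?P) = (\<Sum>u. \<integral>\<^sup>+x. (\<Sum>v. indicator (?E k u v) x) \<partial>?P)"
        by (intro nn_integral_suminf) measurable
      also have "\<dots> = (\<Sum>u. \<Sum>v. \<integral>\<^sup>+x. indicator (?E k u v) x \<partial>?P)"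
        by (intro suminf_cong nn_integral_suminf borel_measurable_indicator E)
      also have "\<dots> = (\<Sum>u. \<Sum>v. emeasure ?P (?E k u v))"
        by (intro suminf_cong nn_integral_indicator E)
      finally show ?thesis by (rule sym)
    qed
    also have "\<dots> \<le> (\<integral>\<^sup>+x. (if n \<le> 2 * num_nodes (fst x) then ennreal (real (card {v. v < num_nodes (fst x) \<and>
        torus_dist n (position (fst x) v) (destination (fst x)) < r})) else 0) \<partial>?P)"
    proof (rule nn_integral_mono)
      fix x assume x: "x \<in> space ?P"
      show "(\<Sum>u. \<Sum>v. indicator (?E k u v) x) \<le> (if n \<le> 2 * num_nodes (fst x) then ennreal (real (card {v. v < num_nodes (fst x) \<and>
        torus_dist n (position (fst x) v) (destination (fst x)) < r})) else 0)"
      proof (cases "n \<le> 2 * num_nodes (fst x)")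
        case True
        then have "indicator (?E k u v) x = (if exposes \<A> c n r (fst x) (snd x) k u v then 1 else (0 :: ennreal))" for u v
          using x by simp
        then show ?thesis using True suminf_exposes_le[of \<A> c n r "fst x" "snd x" k] by (simp only: if_True)
      next
        case False
        then show ?thesis by simp
      qed
    qed
    also have "\<dots> = (\<integral>\<^sup>+w. (if n \<le> 2 * num_nodes w then ennreal (real (card {v. v < num_nodes w \<and>
        torus_dist n (position w v) (destination w) < r})) else 0) \<partial>distr ?P W fst)"
      using near_destination_measurable[of r]
      by (intro nn_integral_distr[symmetric] measurable_fst measurable_If pred_num_nodes[of "\<lambda>m. n \<le> 2 * m", unfolded pred_def]) auto
    also have "\<dots> \<le> ennreal (2 / n) * ennreal (1040 * real n * r\<^sup>2)"
      unfolding fst_P by (rule order_trans[OF nn_integral_near_destination[OF n] mult_left_mono[OF near_int]]) simp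
    also have "\<dots> = ennreal (2080 * r\<^sup>2)"
      using n by (simp add: ennreal_mult[symmetric])
    finally have "emeasure ?P (\<Union>u. \<Union>v. ?B k u v) \<le> ennreal p * ennreal (2080 * r\<^sup>2)"
      by (simp add: mult_left_mono)
    then show ?thesis using p by (simp add: ennreal_mult[symmetric] mult_ac)
  qed
  then have "emeasure ?P ?Bad \<le> (\<Sum>k<K. ennreal (2080 * p * r\<^sup>2))"
    using B by (intro order_trans[OF emeasure_subadditive_finite sum_mono]) (auto intro!: sets.countable_UN)
  also have "\<dots> = ennreal (2080 * real K * p * r\<^sup>2)"
    using p by (simp add: ennreal_of_nat_eq_real_of_nat ennreal_mult[symmetric] mult_ac)
  finally have bad: "emeasure ?P ?Bad \<le> ennreal (2080 * real K * p * r\<^sup>2)" .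
  let ?few = "{w \<in> space W. \<not> n \<le> 2 * num_nodes w}"
  let ?near = "{w \<in> space W. n \<le> 2 * num_nodes w \<and> torus_dist n (source w) (destination w) < r}"
  have sets [measurable]: "?few \<in> sets W" "?near \<in> sets W" by measurable
  have lift: "emeasure ?P (fst -` A \<inter> space ?P) = emeasure W A" if "A \<in> sets W" for A
    using emeasure_distr[OF measurable_fst that, of R] unfolding fst_P by simp
  let ?U = "(fst -` ?few \<inter> space ?P) \<union> (fst -` ?near \<inter> space ?P) \<union> ?Bad"
  have meas: "fst -` ?few \<inter> space ?P \<in> sets ?P" "fst -` ?near \<inter> space ?P \<in> sets ?P"
    using sets by (auto intro: measurable_sets[OF measurable_fst])
  have "AE w in distr ?P W fst. 0 < num_nodes w \<longrightarrow> regular n w"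
    unfolding fst_P by (rule AE_regular)
  then have "AE x in ?P. 0 < num_nodes (fst x) \<longrightarrow> regular n (fst x)"
    by (rule AE_distrD[OF measurable_fst])
  then have "AE x in ?P. x \<in> {x \<in> space ?P. \<exists>k \<le> K. visited \<A> c n (fst x) (snd x) k = destination (fst x)} \<longrightarrow> x \<in> ?U"
  proof eventually_elim
    case (elim x)
    show ?case
    proof (intro impI)
      assume x: "x \<in> {x \<in> space ?P. \<exists>k \<le> K. visited \<A> c n (fst x) (snd x) k = destination (fst x)}"
      then have sp: "x \<in> space ?P" "fst x \<in> space W" by (auto simp: space_pair_measure)
      show "x \<in> ?U"
      proof (rule ccontr)
        assume nU: "x \<notin> ?U"
        then have many: "n \<le> 2 * num_nodes (fst x)" and start: "r \<le> torus_dist n (source (fst x)) (destination (fst x))"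
          using sp by auto
        have "regular n (fst x)" using elim many n by simp
        moreover have "\<not> shortcut (fst x) (link u v)" if "k < K" "exposes \<A> c n r (fst x) (snd x) k u v" for k u v
          using nU that sp many by blast
        ultimately have "visited \<A> c n (fst x) (snd x) k \<noteq> destination (fst x)" if "k \<le> K" for k
          using dec start rad K that by (intro far_imp_hops[where r = r and K = K]) auto
        then show False using x by auto
      qed
    qed
  qed
  then have "emeasure ?P {x \<in> space ?P. \<exists>k \<le> K. visited \<A> c n (fst x) (snd x) k = destination (fst x)} \<le> emeasure ?P ?U"
    using meas Bad by (intro emeasure_mono_AE) auto
  also have "\<dots> \<le> emeasure ?P (fst -` ?few \<inter> space ?P) + emeasure ?P (fst -` ?near \<inter> space ?P) + emeasure ?P ?Bad"
    using meas Bad by (intro order_trans[OF emeasure_subadditive add_right_mono[OF emeasure_subadditive]]) auto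
  also have "\<dots> \<le> ennreal (4 / n) + ennreal (4 / (real n)\<^sup>2) * ennreal (1040 * real n * r\<^sup>2)
      + ennreal (2080 * real K * p * r\<^sup>2)"
    unfolding lift[OF sets(1)] lift[OF sets(2)]
    by (intro add_mono few_nodes[OF n] bad order_trans[OF source_near_destination[OF n] mult_left_mono[OF near_int]]) simp
  also have "\<dots> = ennreal (4 / n + 4160 * r\<^sup>2 / n + 2080 * real K * p * r\<^sup>2)"
  proof -
    have "4 / (real n)\<^sup>2 * (1040 * real n * r\<^sup>2) = 4160 * r\<^sup>2 / n"
      using n by (simp add: power2_eq_square)
    then show ?thesis using p by (simp add: ennreal_mult[symmetric] ennreal_plus[symmetric] del: ennreal_plus)
  qed
  finally show ?thesis .
qed

lemma many_hops_bound:
  assumes RA: "routing_algorithm c n W R \<A>" and n: "0 < n" and \<alpha>: "0 \<le> \<alpha>"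
    and rad: "1 \<le> local_radius c n" and p: "a \<le> p" "0 \<le> p"
    and r: "1 \<le> r" "2 * r \<le> sqrt n" and K: "real K * local_radius c n < r" "y < real K + 1"
  shows "1 - (4 / n + 4160 * r\<^sup>2 / n + 2080 * real K * p * r\<^sup>2) \<le>
    measure (W \<Otimes>\<^sub>M R) {(w, \<rho>) \<in> space (W \<Otimes>\<^sub>M R). ereal y < ereal_of_enat (hops \<A> c n w \<rho>)}"
    and "measure (W \<Otimes>\<^sub>M R) {(w, \<rho>) \<in> space (W \<Otimes>\<^sub>M R). ereal y < ereal_of_enat (hops \<A> c n w \<rho>)} \<le> 1"
proof -
  let ?P = "W \<Otimes>\<^sub>M R"
  let ?b = "4 / n + 4160 * r\<^sup>2 / n + 2080 * real K * p * r\<^sup>2"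
  have R: "prob_space R" using RA by (simp add: routing_algorithm_def)
  interpret R: prob_space R by (rule R)
  interpret pair_prob_space W R ..
  have visited [measurable]: "(\<lambda>x. visited \<A> c n (fst x) (snd x) k) \<in> borel_measurable ?P" for k
    using RA unfolding routing_algorithm_def case_prod_beta' by blast
  let ?F = "{x \<in> space ?P. \<exists>k \<le> K. visited \<A> c n (fst x) (snd x) k = destination (fst x)}"
  let ?G = "{x \<in> space ?P. \<forall>k. real k \<le> y \<longrightarrow> visited \<A> c n (fst x) (snd x) k \<noteq> destination (fst x)}"
  have G: "{(w, \<rho>) \<in> space ?P. ereal y < ereal_of_enat (hops \<A> c n w \<rho>)} = ?G"
    unfolding hops_greater_iff by auto
  have F [measurable]: "?F \<in> sets ?P" by measurable
  have G_sets [measurable]: "?G \<in> sets ?P" by measurable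
  have "emeasure ?P ?F \<le> ennreal ?b"
    by (rule early_arrival_bound[OF RA n \<alpha> rad p r K(1)])
  then have "P.prob ?F \<le> ?b"
    using p n by (subst (asm) P.emeasure_eq_measure, subst (asm) ennreal_le_iff) auto
  moreover have "space ?P - ?F \<subseteq> ?G"
  proof
    fix x assume x: "x \<in> space ?P - ?F"
    have "k \<le> K" if "real k \<le> y" for k using that K(2) by linarith
    then show "x \<in> ?G" using x by auto
  qed
  then have "P.prob (space ?P - ?F) \<le> P.prob ?G" by (intro P.finite_measure_mono G_sets)
  ultimately show "1 - ?b \<le> measure ?P {(w, \<rho>) \<in> space ?P. ereal y < ereal_of_enat (hops \<A> c n w \<rho>)}"
    unfolding G P.prob_compl[OF F] by linarith
  show "measure ?P {(w, \<rho>) \<in> space ?P. ereal y < ereal_of_enat (hops \<A> c n w \<rho>)} \<le> 1"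
    by (rule P.prob_le_1)
qed

end

section \<open>Asymptotics\<close>

text \<open>A connection probability of 1 for all far pairs would give a mean degree of order \<open>n\<close>. This is how
  \<open>4 d < n\<close> removes the minimum with 1 from the lower bound for the mean degree.\<close>

lemma normalisation_bound:
  fixes n :: nat
  assumes "poisson_small_world c \<alpha> a n W" "0 \<le> \<alpha>" "0 \<le> local_radius c n" "0 < n"
    and "1 \<le> r" "2 * r \<le> sqrt n" "local_radius c n < r" "1040 * real n * r\<^sup>2 \<le> (real n)\<^sup>2 / 2"
    and "mean_shortcuts W = d" "0 < d" and small: "4 * d < n"
  shows "a \<le> 4 * d * real n powr (\<alpha> / 2 - 1)"
proof -
  interpret small_world c \<alpha> a n W by unfold_locales fact
  have "min (a * sqrt n powr - \<alpha>) 1 \<le> 4 * d / n"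
    by (rule mean_shortcuts_ge) fact+
  moreover have "4 * d / n < 1" using small assms(4) by simp
  ultimately have "a * sqrt n powr - \<alpha> \<le> 4 * d / n" by simp
  moreover have "sqrt n powr - \<alpha> = real n powr (- \<alpha> / 2)"
    using assms(4) by (simp add: powr_half_sqrt[symmetric] powr_powr)
  ultimately have "a * real n powr (- \<alpha> / 2) * real n powr (\<alpha> / 2) \<le> 4 * d / n * real n powr (\<alpha> / 2)"
    by (intro mult_right_mono) auto
  then show ?thesis using assms(4)
    by (simp add: powr_add[symmetric] powr_diff mult.assoc)
qed

theorem theorem4p1:
  fixes \<alpha> c d \<gamma> :: real
    and a :: "nat \<Rightarrow> real"
    and W :: "nat \<Rightarrow> network measure"
    and R :: "nat \<Rightarrow> 'r measure"
    and \<A> :: "nat \<Rightarrow> 'r algorithm"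
  assumes "0 < \<alpha>" and "\<alpha> < 2" and "0 < c" and "0 < d"
    and "\<forall>\<^sub>F n in sequentially. poisson_small_world c \<alpha> (a n) n (W n)"
    and "\<forall>\<^sub>F n in sequentially. mean_shortcuts (W n) = d"
    and "\<forall>\<^sub>F n in sequentially. routing_algorithm c n (W n) (R n) (\<A> n)"
    and "\<gamma> < (2 - \<alpha>) / 6"
  shows "(\<lambda>n. measure (W n \<Otimes>\<^sub>M R n)
            {(w, \<rho>) \<in> space (W n \<Otimes>\<^sub>M R n).
               ereal (real n powr \<gamma>) < ereal_of_enat (hops (\<A> n) c n w \<rho>)})
         \<longlonglongrightarrow> 1"
proof -
  define \<gamma>' where "\<gamma>' = max \<gamma> 0"
  have \<gamma>': "0 \<le> \<gamma>'" "\<gamma> \<le> \<gamma>'" "\<gamma>' < (2 - \<alpha>) / 6" using assms by (auto simp: \<gamma>'_def)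
  \<comment> \<open>\<open>\<gamma>' < \<delta>\<close> makes local steps too short, and \<open>\<gamma>' + 2 \<delta> < 1 - \<alpha> / 2\<close> makes shortcuts too rare.
    Both can be met since \<open>3 (2 - \<alpha>) / 6 = 1 - \<alpha> / 2\<close>, which is the origin of the denominator 6.\<close>
  obtain \<delta> where \<delta>: "\<gamma>' < \<delta>" "\<delta> < (2 - \<alpha>) / 6" using dense[OF \<gamma>'(3)] by blast
  have \<delta>': "6 * \<delta> < 2 - \<alpha>" "0 < \<delta>" using \<delta> \<gamma>' by simp_all
  define K where "K n = nat \<lfloor>real n powr \<gamma>'\<rfloor>" for n :: nat
  define bound where "bound n = 4 / n + 4160 * real n powr (2 * \<delta> - 1)
      + 8320 * d * real n powr (\<gamma>' + (\<alpha> / 2 - 1) + 2 * \<delta>)" for n :: nat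
  let ?p = "\<lambda>n. measure (W n \<Otimes>\<^sub>M R n) {(w, \<rho>) \<in> space (W n \<Otimes>\<^sub>M R n).
               ereal (real n powr \<gamma>) < ereal_of_enat (hops (\<A> n) c n w \<rho>)}"
  have 1: "2 * \<delta> - 1 < 0" and 2: "\<gamma>' + (\<alpha> / 2 - 1) + 2 * \<delta> < 0" and 3: "\<delta> - 1 / 2 < 0"
    using \<delta>(1) \<delta>' assms(1) by simp_all
  have tendsto_powr: "(\<lambda>n. real n powr e) \<longlonglongrightarrow> 0" if "e < 0" for e
    using that by (intro tendsto_neg_powr filterlim_real_sequentially)
  have "bound \<longlonglongrightarrow> 0 + 4160 * 0 + 8320 * d * 0"
    unfolding bound_def by (intro tendsto_intros tendsto_powr 1 2 lim_const_over_n)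
  then have bound_lim: "(\<lambda>n. 1 - bound n) \<longlonglongrightarrow> 1"
    using tendsto_diff[OF tendsto_const[of 1], of bound 0] by simp
  have rad: "\<forall>\<^sub>F n in sequentially. 1 \<le> local_radius c n"
    unfolding local_radius_def using \<open>0 < c\<close> by real_asymp
  have "\<forall>\<^sub>F n in sequentially. real n powr (\<delta> - 1 / 2) < 1 / 2"
    by (rule order_tendstoD(2)[OF tendsto_powr[OF 3]]) simp
  then have r_small: "\<forall>\<^sub>F n in sequentially. 2 * real n powr \<delta> \<le> sqrt n"
    using eventually_gt_at_top[of 0]
  proof eventually_elim
    case (elim n)
    then have "real n powr \<delta> = sqrt n * real n powr (\<delta> - 1 / 2)"
      by (simp add: powr_half_sqrt[symmetric] powr_add[symmetric])
    then show ?case using mult_left_mono[of "real n powr (\<delta> - 1 / 2)" "1 / 2" "sqrt n"] elim by simp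
  qed
  have K_small: "\<forall>\<^sub>F n in sequentially. real n powr \<gamma>' * local_radius c n < real n powr \<delta>"
    unfolding local_radius_def using \<open>0 < c\<close> \<delta>(1) by real_asymp
  have norm1: "\<forall>\<^sub>F n in sequentially. 2 * (local_radius c n + 1) \<le> sqrt n"
    unfolding local_radius_def using \<open>0 < c\<close> by real_asymp
  have norm2: "\<forall>\<^sub>F n in sequentially. 1040 * real n * (local_radius c n + 1)\<^sup>2 \<le> (real n)\<^sup>2 / 2"
    unfolding local_radius_def using \<open>0 < c\<close> by real_asymp
  have norm3: "\<forall>\<^sub>F n in sequentially. 4 * d < real n"
    by real_asymp
  have main: "\<forall>\<^sub>F n in sequentially. 1 - bound n \<le> ?p n \<and> ?p n \<le> 1"
    using assms(5,6,7) rad r_small K_small norm1 norm2 norm3 eventually_gt_at_top[of 0]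
  proof eventually_elim
    case (elim n)
    interpret small_world c \<alpha> "a n" n "W n" by unfold_locales fact
    let ?q = "4 * d * real n powr (\<alpha> / 2 - 1)" and ?r = "real n powr \<delta>"
    have n: "1 \<le> real n" using elim by simp
    \<comment> \<open>Any radius slightly above the local radius serves to separate far pairs from close ones.\<close>
    have a: "a n \<le> ?q"
      using elim assms by (intro normalisation_bound[where r = "local_radius c n + 1"]) auto
    have K: "real (K n) \<le> real n powr \<gamma>'" "real n powr \<gamma>' < real (K n) + 1"
      unfolding K_def using n by (auto simp: of_nat_nat)
    have "real (K n) * local_radius c n \<le> real n powr \<gamma>' * local_radius c n"
      using K elim by (intro mult_right_mono) auto
    then have K': "real (K n) * local_radius c n < ?r" using elim by linarith
    have y: "real n powr \<gamma> < real (K n) + 1"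
      using K powr_mono[OF \<gamma>'(2) n] by linarith
    have r: "1 \<le> ?r" using n \<delta>' by (intro ge_one_powr_ge_zero) auto
    note b = many_hops_bound[OF _ _ _ _ a _ r _ K' y]
    have "4 / n + 4160 * ?r\<^sup>2 / n + 2080 * real (K n) * ?q * ?r\<^sup>2 \<le>
        4 / n + 4160 * ?r\<^sup>2 / n + 2080 * real n powr \<gamma>' * ?q * ?r\<^sup>2"
      using K assms by (intro add_left_mono mult_right_mono mult_left_mono) auto
    also have "\<dots> = bound n"
    proof -
      have "?r\<^sup>2 = real n powr (2 * \<delta>)"
        by (simp add: power2_eq_square powr_add[symmetric])
      moreover have "4160 * real n powr (2 * \<delta>) / n = 4160 * real n powr (2 * \<delta> - 1)"
        using n by (simp add: powr_diff)
      moreover have "2080 * real n powr \<gamma>' * ?q * real n powr (2 * \<delta>) =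
          8320 * d * real n powr (\<gamma>' + (\<alpha> / 2 - 1) + 2 * \<delta>)"
        by (simp add: powr_add)
      ultimately show ?thesis by (simp only: bound_def)
    qed
    finally show ?case
      using b[of "R n" "\<A> n"] elim assms by auto
  qed
  show ?thesis
  proof (rule tendsto_sandwich[OF _ _ bound_lim tendsto_const])
    show "\<forall>\<^sub>F n in sequentially. 1 - bound n \<le> ?p n" using main by eventually_elim simp
    show "\<forall>\<^sub>F n in sequentially. ?p n \<le> 1" using main by eventually_elim simp
  qed
qed

end
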